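(* Assume that the uri multiplicities $\mu_{a,\boldsymbol\alpha}$ satisfy the threshold shuffle identities (see context). Then $(\mathrm{Lie}(V),[\cdot,\cdot],\triangleright_u)$ is a post-Lie algebra.
   Context: $V=\{v_0,v_1,\dots\}$, $\mathbb N=\{1,2,\dots\}$. Ari multiplicity: $\mathrm m_{\mathbf k,\mathbf l}=(-1)^{|\mathbf k|+|\mathbf l|}\prod_i\binom{k_i-1}{l_i-1}$ for $\mathbf k,\mathbf l\in\mathbb Z_{\ge0}^d$ ($|\cdot|$ = sum of entries), with $\binom{-1}{-1}=1$, $\binom{k-1}{-1}=\binom{-1}{l-1}=0$ for $k,l>0$, usual binomials otherwise. $\mathcal C(n)$ is the set of compositions $\boldsymbol\alpha=(\alpha_1,\dots,\alpha_{\ell(\boldsymbol\alpha)})\in\mathbb N^{\ell(\boldsymbol\alpha)}$ of $n$. Threshold indicator: for a finite sequence $\boldsymbol\alpha$ of integers and $a\in\mathbb Z$, $\mathrm{ind}_a(\boldsymbol\alpha)=\min\{j:\alpha_1+\dots+\alpha_j\ge a\}$, set to $0$ if $\boldsymbol\alpha=\emptyset$ or $a>|\boldsymbol\alpha|$. With Bernoulli numbers $B_k$ ($B_1=-\frac12$) let $B_1(m,n)=\frac1{m!}\sum_{k=0}^{n-1}\binom mkB_k$, and define $\mu_{a,\boldsymbol\alpha}=B_1(\ell(\boldsymbol\alpha),\mathrm{ind}_a(\boldsymbol\alpha))$ ($=0$ if $\mathrm{ind}_a(\boldsymbol\alpha)=0$), extended linearly to formal $\mathbb Z$-linear combinations of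 sequences in the second argument. Concatenation $(\mathbf k,\mathbf l)$ and the shuffle product $⧢$ of sequences are extended bilinearly; for $\mathbf k=(k_1,\dots,k_d)$, $\overline{\mathbf k}=(-1)^d(k_d,\dots,k_1)$; a decomposition $(\mathbf k_1,\mathbf k_2)=\mathbf k$ means $\mathbf k$ is the concatenation, either part possibly empty. Threshold shuffle identities: (i) for all $\boldsymbol\sigma,\boldsymbol\vartheta$ with entries in $\mathbb N$ and all $d_1,d_2\in\mathbb Z_{\ge0}$, with $t=|\boldsymbol\sigma|+|\boldsymbol\vartheta|-d_1-d_2$: $\mu_{t,\boldsymbol\sigma⧢\boldsymbol\vartheta}=\sum_{(\boldsymbol\sigma_1,\boldsymbol\sigma_2)=\boldsymbol\sigma,\,(\boldsymbol\vartheta_1,\boldsymbol\vartheta_2)=\boldsymbol\vartheta}\big(\mu_{|\boldsymbol\sigma_2|-d_1,\boldsymbol\sigma_2}\,\mu_{t,(\boldsymbol\sigma_1⧢\boldsymbol\vartheta_1,|\boldsymbol\sigma_2|-d_1,\boldsymbol\vartheta_2)}+\mu_{|\boldsymbol\vartheta_2|-d_2,\boldsymbol\vartheta_2}\,\mu_{t,(\boldsymbol\sigma_1⧢\boldsymbol\vartheta_1,|\boldsymbol\vartheta_2|-d_2,\boldsymbol\sigma_2)}\big)$; (ii) for all $\boldsymbol\sigma,\boldsymbol\tau,\boldsymbol\vartheta$ with entries in $\mathbb N$ and $d_1,d_2\in\mathbb Z_{\ge0}$, with $t=|\boldsymbol\sigma|+|\boldsymbol\tau|+|\boldsymbol\vartheta|-d_1-d_2$: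 $0=\sum_{(\boldsymbol\sigma_1,\boldsymbol\sigma_2)=\boldsymbol\sigma,(\boldsymbol\tau_1,\boldsymbol\tau_2)=\boldsymbol\tau,(\boldsymbol\vartheta_1,\boldsymbol\vartheta_2)=\boldsymbol\vartheta}\big(\mu_{|\boldsymbol\sigma_2|+|\boldsymbol\tau_1|-d_1,\boldsymbol\sigma_2⧢\overline{\boldsymbol\tau_1}}\,\mu_{t,(\boldsymbol\sigma_1⧢\overline{\boldsymbol\vartheta_2},|\boldsymbol\sigma_2|+|\boldsymbol\tau_1|-d_1,\boldsymbol\tau_2⧢\overline{\boldsymbol\vartheta_1})}+\mu_{|\boldsymbol\tau_2|+|\boldsymbol\vartheta_1|-d_2,\boldsymbol\tau_2⧢\overline{\boldsymbol\vartheta_1}}\,\mu_{t,(\boldsymbol\sigma_1⧢\overline{\boldsymbol\vartheta_2},|\boldsymbol\tau_2|+|\boldsymbol\vartheta_1|-d_2,\boldsymbol\sigma_2⧢\overline{\boldsymbol\tau_1})}\big)$. The map $\triangleright_u$: on the free magma $M(V)$ (product $\star$), for $t=t(\mathbf k)$ a bracketing of letters $v_{k_1},\dots,v_{k_d}$ and $t(\mathbf l)$ the same bracketing of $v_{l_1},\dots,v_{l_d}$, set $t(\mathbf k)\triangleright_uv_0=0$ and for $a\ge1$, $t(\mathbf k)\triangleright_uv_a=\sum_{\mathbf l\in\mathbb Z_{\ge0}^d}\mathrm m_{\mathbf k,\mathbf l}\sum_{\boldsymbol\alpha\in\mathcal C(a+|\mathbf k|-|\mathbf l|)}\mu_{a,\boldsymbol\alpha}\,v_{\alpha_1}\star(v_{\alpha_2}\star(\cdots\star(v_{\alpha_{\ell(\boldsymbol\alpha)}}\star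 t(\mathbf l))\cdots))$; extend linearly in $t$ and as a derivation of $(M(V)_{\mathbb Q},\star)$ in the second argument. This descends, via the homomorphism $M(V)_{\mathbb Q}\to\mathrm{Lie}(V)$ (identity on $V$, $a\star b\mapsto[a,b]$), to a bilinear map $\triangleright_u$ on the free Lie algebra $\mathrm{Lie}(V)$. A post-Lie algebra is a Lie algebra with bilinear $\triangleright$ satisfying $x\triangleright[y,z]=[x\triangleright y,z]+[y,x\triangleright z]$ and $[x,y]\triangleright z=x\triangleright(y\triangleright z)-(x\triangleright y)\triangleright z-y\triangleright(x\triangleright z)+(y\triangleright x)\triangleright z$.
   Formalization: Threshold shuffle identity (ii) is assumed only for nonempty τ: for τ=∅ it contradicts identity (i) (take σ=(1), ϑ=∅, d_1=d_2=0, where μ_{1,(1)}=1≠0); in ind_a the minimum is over j≥0, so ind_a=0 for a≤0. *)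

theory Defs
  imports Complex_Main "HOL-Library.Poly_Mapping"
begin

section \<open>Post-Lie algebras\<close>

locale lie_algebra = vector_space scale
  for scale :: "'k::field \<Rightarrow> 'a::ab_group_add \<Rightarrow> 'a" +
  fixes br :: "'a \<Rightarrow> 'a \<Rightarrow> 'a"
  assumes br_linear_left: "Vector_Spaces.linear scale scale (\<lambda>x. br x y)"
    and br_linear_right: "Vector_Spaces.linear scale scale (\<lambda>y. br x y)"
    and br_self: "br x x = 0"
    and br_jacobi: "br x (br y z) + br y (br z x) + br z (br x y) = 0"

locale post_lie_algebra = lie_algebra scale br
  for scale :: "'k::field \<Rightarrow> 'a::ab_group_add \<Rightarrow> 'a"
    and br :: "'a \<Rightarrow> 'a \<Rightarrow> 'a" +
  fixes tri :: "'a \<Rightarrow> 'a \<Rightarrow> 'a"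
  assumes tri_linear_left: "Vector_Spaces.linear scale scale (\<lambda>x. tri x y)"
    and tri_linear_right: "Vector_Spaces.linear scale scale (\<lambda>y. tri x y)"
    and tri_derivation: "tri x (br y z) = br (tri x y) z + br y (tri x z)"
    and tri_br: "tri (br x y) z =
      tri x (tri y z) - tri (tri x y) z - tri y (tri x z) + tri (tri y x) z"


section \<open>The free Lie algebra over the rationals\<close>

datatype 'v magma = Gen 'v | Star "'v magma" "'v magma" (infixr \<open>\<star>\<close> 70)

definition qscale :: "rat \<Rightarrow> ('a \<Rightarrow>\<^sub>0 rat) \<Rightarrow> 'a \<Rightarrow>\<^sub>0 rat" where
  "qscale c x = Poly_Mapping.map ((*) c) x"

definition lin_ext :: "('a \<Rightarrow> 'b \<Rightarrow>\<^sub>0 rat) \<Rightarrow> ('a \<Rightarrow>\<^sub>0 rat) \<Rightarrow> 'b \<Rightarrow>\<^sub>0 rat" where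
  "lin_ext f x = (\<Sum>i\<in>Poly_Mapping.keys x. qscale (Poly_Mapping.lookup x i) (f i))"

definition bilin_ext ::
    "('a \<Rightarrow> 'b \<Rightarrow> 'c \<Rightarrow>\<^sub>0 rat) \<Rightarrow> ('a \<Rightarrow>\<^sub>0 rat) \<Rightarrow> ('b \<Rightarrow>\<^sub>0 rat) \<Rightarrow> 'c \<Rightarrow>\<^sub>0 rat" where
  "bilin_ext f x y = lin_ext (\<lambda>i. lin_ext (\<lambda>j. f i j) y) x"

abbreviation qof :: "'a \<Rightarrow> 'a \<Rightarrow>\<^sub>0 rat" where
  "qof a \<equiv> Poly_Mapping.single a 1"

definition mprod :: "('v magma \<Rightarrow>\<^sub>0 rat) \<Rightarrow> ('v magma \<Rightarrow>\<^sub>0 rat) \<Rightarrow> 'v magma \<Rightarrow>\<^sub>0 rat" where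
  "mprod = bilin_ext (\<lambda>s t. qof (s \<star> t))"

text \<open>
  The two-sided ideal of the free non-associative algebra generated by the alternativity and
  Jacobi relators; the free Lie algebra is the quotient by it.
\<close>

inductive_set lie_ideal :: "('v magma \<Rightarrow>\<^sub>0 rat) set" where
  lie_ideal_zero: "0 \<in> lie_ideal"
| lie_ideal_add: "x \<in> lie_ideal \<Longrightarrow> y \<in> lie_ideal \<Longrightarrow> x + y \<in> lie_ideal"
| lie_ideal_scale: "x \<in> lie_ideal \<Longrightarrow> qscale c x \<in> lie_ideal"
| lie_ideal_left: "x \<in> lie_ideal \<Longrightarrow> mprod w x \<in> lie_ideal"
| lie_ideal_right: "x \<in> lie_ideal \<Longrightarrow> mprod x w \<in> lie_ideal"
| lie_ideal_self: "mprod x x \<in> lie_ideal"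
| lie_ideal_jacobi:
    "mprod x (mprod y z) + mprod y (mprod z x) + mprod z (mprod x y) \<in> lie_ideal"

lemma lookup_qscale [simp]: "Poly_Mapping.lookup (qscale c x) i = c * Poly_Mapping.lookup x i"
  by (simp add: qscale_def Poly_Mapping.map.rep_eq when_def)

lemma vector_space_qscale: "vector_space qscale"
  by standard (simp_all add: poly_mapping_eq_iff fun_eq_iff lookup_add algebra_simps)

interpretation qs: vector_space qscale
  by (rule vector_space_qscale)

lemma lie_ideal_uminus: "x \<in> lie_ideal \<Longrightarrow> - x \<in> lie_ideal"
  using lie_ideal_scale[of x "-1"] by simp

lemma lie_ideal_diff: "x \<in> lie_ideal \<Longrightarrow> y \<in> lie_ideal \<Longrightarrow> x - y \<in> lie_ideal"
  using lie_ideal_add[of x "- y"] lie_ideal_uminus[of y] by simp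

lemma lie_ideal_sum: "(\<And>i. i \<in> A \<Longrightarrow> f i \<in> lie_ideal) \<Longrightarrow> sum f A \<in> lie_ideal"
  by (induction A rule: infinite_finite_induct)
    (auto intro: lie_ideal_zero lie_ideal_add)

lemma lin_ext_superset:
  assumes "finite A" "Poly_Mapping.keys x \<subseteq> A"
  shows "lin_ext f x = (\<Sum>i\<in>A. qscale (Poly_Mapping.lookup x i) (f i))"
  unfolding lin_ext_def using assms
  by (intro sum.mono_neutral_left) (auto simp: in_keys_iff)

lemma lin_ext_zero [simp]: "lin_ext f 0 = 0"
  by (simp add: lin_ext_def)

lemma lin_ext_qof [simp]: "lin_ext f (qof i) = f i"
  by (simp add: lin_ext_def)

lemma lin_ext_add: "lin_ext f (x + y) = lin_ext f x + lin_ext f y"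
proof -
  let ?A = "Poly_Mapping.keys x \<union> Poly_Mapping.keys y"
  have "lin_ext f z = (\<Sum>i\<in>?A. qscale (Poly_Mapping.lookup z i) (f i))"
    if "Poly_Mapping.keys z \<subseteq> ?A" for z
    by (rule lin_ext_superset) (use that in auto)
  then show ?thesis
    using Poly_Mapping.keys_add[of x y]
    by (simp add: lookup_add qs.scale_left_distrib sum.distrib)
qed

lemma lin_ext_scale: "lin_ext f (qscale c x) = qscale c (lin_ext f x)"
proof -
  have "lin_ext f (qscale c x) =
      (\<Sum>i\<in>Poly_Mapping.keys x. qscale (Poly_Mapping.lookup (qscale c x) i) (f i))"
    by (rule lin_ext_superset) (auto simp: in_keys_iff)
  then show ?thesis
    by (simp add: lin_ext_def qs.scale_sum_right)
qed

lemma lin_ext_uminus: "lin_ext f (- x) = - lin_ext f x"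
  using lin_ext_scale[of f "-1" x] by simp

lemma lin_ext_diff: "lin_ext f (x - y) = lin_ext f x - lin_ext f y"
  using lin_ext_add[of f x "- y"] by (simp add: lin_ext_uminus)

lemma lin_ext_sum: "lin_ext f (sum g A) = (\<Sum>i\<in>A. lin_ext f (g i))"
  by (induction A rule: infinite_finite_induct) (auto simp: lin_ext_add)

lemma lin_ext_plus_fun: "lin_ext (\<lambda>i. f i + g i) x = lin_ext f x + lin_ext g x"
  by (simp add: lin_ext_def qs.scale_right_distrib sum.distrib)

lemma lin_ext_scale_fun: "lin_ext (\<lambda>i. qscale c (f i)) x = qscale c (lin_ext f x)"
  by (simp add: lin_ext_def qs.scale_sum_right mult.commute)

lemma lin_ext_qof_id [simp]: "lin_ext qof x = x"
proof (rule poly_mapping_eqI)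
  fix k
  have "Poly_Mapping.lookup (lin_ext qof x) k =
      (\<Sum>i\<in>Poly_Mapping.keys x. if i = k then Poly_Mapping.lookup x i else 0)"
    by (simp add: lin_ext_def lookup_sum lookup_single when_def if_distrib cong: if_cong)
  then show "Poly_Mapping.lookup (lin_ext qof x) k = Poly_Mapping.lookup x k"
    by (simp add: in_keys_iff)
qed

lemma free_rat_induct [case_names zero add scale qof]:
  assumes "P 0" "\<And>x y. P x \<Longrightarrow> P y \<Longrightarrow> P (x + y)" "\<And>c x. P x \<Longrightarrow> P (qscale c x)"
    and "\<And>i. P (qof i)"
  shows "P (x :: 'a \<Rightarrow>\<^sub>0 rat)"
proof -
  have "P (\<Sum>i\<in>A. qscale (Poly_Mapping.lookup x i) (qof i))" if "finite A" for A
    using that by induction (use assms in auto)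
  from this[of "Poly_Mapping.keys x"] have "P (lin_ext qof x)"
    by (simp only: lin_ext_def finite_keys)
  then show ?thesis by (simp only: lin_ext_qof_id)
qed

lemma bilin_ext_qof [simp]: "bilin_ext f (qof i) (qof j) = f i j"
  by (simp add: bilin_ext_def)

lemma bilin_ext_zero [simp]: "bilin_ext f 0 y = 0" "bilin_ext f x 0 = 0"
  by (simp_all add: bilin_ext_def lin_ext_def)

lemma bilin_ext_add:
  "bilin_ext f (x + x') y = bilin_ext f x y + bilin_ext f x' y"
  "bilin_ext f x (y + y') = bilin_ext f x y + bilin_ext f x y'"
  by (simp_all add: bilin_ext_def lin_ext_add lin_ext_plus_fun)

lemma bilin_ext_scale:
  "bilin_ext f (qscale c x) y = qscale c (bilin_ext f x y)"
  "bilin_ext f x (qscale c y) = qscale c (bilin_ext f x y)"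
  by (simp_all add: bilin_ext_def lin_ext_scale lin_ext_scale_fun)

lemma bilin_ext_uminus:
  "bilin_ext f (- x) y = - bilin_ext f x y"
  "bilin_ext f x (- y) = - bilin_ext f x y"
  using bilin_ext_scale(1)[of f "-1" x y] bilin_ext_scale(2)[of f x "-1" y] by simp_all

lemma bilin_ext_diff:
  "bilin_ext f (x - x') y = bilin_ext f x y - bilin_ext f x' y"
  "bilin_ext f x (y - y') = bilin_ext f x y - bilin_ext f x y'"
  using bilin_ext_add(1)[of f x "- x'" y] bilin_ext_add(2)[of f x y "- y'"]
  by (simp_all add: bilin_ext_uminus)

lemmas mprod_simps =
  bilin_ext_qof[of "\<lambda>s t. qof (s \<star> t)", folded mprod_def]
  bilin_ext_zero[of "\<lambda>s t. qof (s \<star> t)", folded mprod_def]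
  bilin_ext_add[of "\<lambda>s t. qof (s \<star> t)", folded mprod_def]
  bilin_ext_scale[of "\<lambda>s t. qof (s \<star> t)", folded mprod_def]
  bilin_ext_uminus[of "\<lambda>s t. qof (s \<star> t)", folded mprod_def]
  bilin_ext_diff[of "\<lambda>s t. qof (s \<star> t)", folded mprod_def]

lemma mprod_sum:
  "mprod (sum f A) y = (\<Sum>i\<in>A. mprod (f i) y)"
  "mprod y (sum f A) = (\<Sum>i\<in>A. mprod y (f i))"
  by (induction A rule: infinite_finite_induct) (auto simp: mprod_simps)

lemma lie_ideal_anticomm: "mprod x y + mprod y x \<in> lie_ideal"
proof -
  have "mprod (x + y) (x + y) - mprod x x - mprod y y \<in> lie_ideal"
    by (intro lie_ideal_diff lie_ideal_self)
  then show ?thesis by (simp add: mprod_simps algebra_simps)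
qed

quotient_type 'v free_lie = "'v magma \<Rightarrow>\<^sub>0 rat" / "\<lambda>x y. x - y \<in> lie_ideal"
proof (rule equivpI)
  show "reflp (\<lambda>x y :: 'v magma \<Rightarrow>\<^sub>0 rat. x - y \<in> lie_ideal)"
    by (auto simp: reflp_def intro: lie_ideal_zero)
  show "symp (\<lambda>x y :: 'v magma \<Rightarrow>\<^sub>0 rat. x - y \<in> lie_ideal)"
    by (auto simp: symp_def dest: lie_ideal_uminus)
  show "transp (\<lambda>x y :: 'v magma \<Rightarrow>\<^sub>0 rat. x - y \<in> lie_ideal)"
    by (auto simp: transp_def dest: lie_ideal_add)
qed

instantiation free_lie :: (type) ab_group_add
begin

lift_definition zero_free_lie :: "'v free_lie" is 0 .

lift_definition plus_free_lie :: "'v free_lie \<Rightarrow> 'v free_lie \<Rightarrow> 'v free_lie" is "(+)"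
  using lie_ideal_add by (fastforce simp: add_diff_add)

lift_definition uminus_free_lie :: "'v free_lie \<Rightarrow> 'v free_lie" is uminus
  using lie_ideal_uminus by (fastforce simp: minus_diff_minus)

lift_definition minus_free_lie :: "'v free_lie \<Rightarrow> 'v free_lie \<Rightarrow> 'v free_lie" is "(-)"
proof -
  fix x x' y y' :: "'v magma \<Rightarrow>\<^sub>0 rat"
  assume "x - x' \<in> lie_ideal" "y - y' \<in> lie_ideal"
  from lie_ideal_diff[OF this] show "(x - y) - (x' - y') \<in> lie_ideal"
    by (simp add: algebra_simps)
qed

instance
  by standard (transfer; simp add: algebra_simps lie_ideal_zero)+

end

lift_definition free_lie_scale :: "rat \<Rightarrow> 'v free_lie \<Rightarrow> 'v free_lie" is qscale
  by (simp only: qs.scale_right_diff_distrib[symmetric] lie_ideal_scale)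

lift_definition free_lie_bracket :: "'v free_lie \<Rightarrow> 'v free_lie \<Rightarrow> 'v free_lie" is mprod
proof -
  fix x x' y y' :: "'v magma \<Rightarrow>\<^sub>0 rat"
  assume "x - x' \<in> lie_ideal" "y - y' \<in> lie_ideal"
  then have "mprod (x - x') y + mprod x' (y - y') \<in> lie_ideal"
    by (intro lie_ideal_add lie_ideal_left lie_ideal_right)
  then show "mprod x y - mprod x' y' \<in> lie_ideal"
    by (simp add: mprod_simps)
qed


section \<open>Uri multiplicities\<close>

text \<open>The index ranges over \<open>{0..length \<alpha>}\<close>, so that the value is \<open>0\<close> whenever \<open>a \<le> 0\<close>:
  the empty partial sum is already at least \<open>a\<close>.\<close>

definition threshold_ind :: "int \<Rightarrow> int list \<Rightarrow> nat" where
  "threshold_ind a \<alpha> =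
    (if \<alpha> = [] \<or> a > sum_list \<alpha> then 0
     else (LEAST j. j \<le> length \<alpha> \<and> a \<le> sum_list (take j \<alpha>)))"

fun bernoulli :: "nat \<Rightarrow> rat" where
  "bernoulli n =
    (if n = 0 then 1
     else - (\<Sum>k<n. of_nat (Suc n choose k) * bernoulli k) / of_nat (Suc n))"

declare bernoulli.simps [simp del]

lemma "bernoulli 1 = - (1 / 2)"
  by (simp add: bernoulli.simps)

definition bernoulli_one :: "nat \<Rightarrow> nat \<Rightarrow> rat" where
  "bernoulli_one m n = (\<Sum>k<n. of_nat (m choose k) * bernoulli k) / fact m"

definition uri_mult :: "int \<Rightarrow> int list \<Rightarrow> rat" where
  "uri_mult a \<alpha> = bernoulli_one (length \<alpha>) (threshold_ind a \<alpha>)"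

definition uri_mult_ext :: "int \<Rightarrow> (int list \<Rightarrow>\<^sub>0 int) \<Rightarrow> rat" where
  "uri_mult_ext a x =
    (\<Sum>\<alpha>\<in>Poly_Mapping.keys x. of_int (Poly_Mapping.lookup x \<alpha>) * uri_mult a \<alpha>)"


section \<open>Threshold shuffle identities\<close>

fun shuffle_seq :: "int list \<Rightarrow> int list \<Rightarrow> int list \<Rightarrow>\<^sub>0 int" where
  "shuffle_seq [] ys = frag_of ys"
| "shuffle_seq xs [] = frag_of xs"
| "shuffle_seq (x # xs) (y # ys) =
    frag_extend (\<lambda>w. frag_of (x # w)) (shuffle_seq xs (y # ys)) +
    frag_extend (\<lambda>w. frag_of (y # w)) (shuffle_seq (x # xs) ys)"

definition shuffle ::
    "(int list \<Rightarrow>\<^sub>0 int) \<Rightarrow> (int list \<Rightarrow>\<^sub>0 int) \<Rightarrow> int list \<Rightarrow>\<^sub>0 int" (infixl \<open>\<bowtie>\<close> 75) where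
  "x \<bowtie> y = frag_extend (\<lambda>u. frag_extend (\<lambda>w. shuffle_seq u w) y) x"

definition conc ::
    "(int list \<Rightarrow>\<^sub>0 int) \<Rightarrow> (int list \<Rightarrow>\<^sub>0 int) \<Rightarrow> int list \<Rightarrow>\<^sub>0 int" (infixr \<open>\<odot>\<close> 70) where
  "x \<odot> y = frag_extend (\<lambda>u. frag_extend (\<lambda>w. frag_of (u @ w)) y) x"

definition signed_rev :: "int list \<Rightarrow> int list \<Rightarrow>\<^sub>0 int" where
  "signed_rev k = frag_cmul ((- 1) ^ length k) (frag_of (rev k))"

definition decomps :: "'a list \<Rightarrow> ('a list \<times> 'a list) set" where
  "decomps k = {(k1, k2). k1 @ k2 = k}"

lemma finite_decomps: "finite (decomps k)"
proof -
  have "decomps k \<subseteq> (\<lambda>n. (take n k, drop n k)) ` {..length k}"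
  proof
    fix p assume "p \<in> decomps k"
    then have "p = (take (length (fst p)) k, drop (length (fst p)) k)" "length (fst p) \<le> length k"
      by (auto simp: decomps_def)
    then show "p \<in> (\<lambda>n. (take n k, drop n k)) ` {..length k}"
      by blast
  qed
  then show ?thesis by (rule finite_subset) simp
qed

definition pos_entries :: "int list \<Rightarrow> bool" where
  "pos_entries k \<longleftrightarrow> (\<forall>x\<in>set k. 1 \<le> x)"

definition threshold_shuffle_identity_1 :: bool where
  "threshold_shuffle_identity_1 \<longleftrightarrow>
    (\<forall>\<sigma> \<theta> (d1::nat) (d2::nat) t.
      pos_entries \<sigma> \<longrightarrow> pos_entries \<theta> \<longrightarrow>
      t = sum_list \<sigma> + sum_list \<theta> - int d1 - int d2 \<longrightarrow>
      uri_mult_ext t (frag_of \<sigma> \<bowtie> frag_of \<theta>) =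
      (\<Sum>(\<sigma>1, \<sigma>2)\<in>decomps \<sigma>. \<Sum>(\<theta>1, \<theta>2)\<in>decomps \<theta>.
        uri_mult (sum_list \<sigma>2 - int d1) \<sigma>2 *
        uri_mult_ext t
          (frag_of \<sigma>1 \<bowtie> frag_of \<theta>1 \<odot> frag_of [sum_list \<sigma>2 - int d1] \<odot> frag_of \<theta>2) +
        uri_mult (sum_list \<theta>2 - int d2) \<theta>2 *
        uri_mult_ext t
          (frag_of \<sigma>1 \<bowtie> frag_of \<theta>1 \<odot> frag_of [sum_list \<theta>2 - int d2] \<odot> frag_of \<sigma>2)))"

text \<open>
  The middle sequence \<open>\<tau>\<close> has to be nonempty here. For \<open>\<tau> = []\<close> the sum below is the right-hand
  side of the first identity with \<open>\<theta>\<close> replaced by \<open>signed_rev \<theta>\<close>, so requiring it to vanish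
  would contradict the first identity (take \<open>\<sigma> = [1]\<close>, \<open>\<theta> = []\<close>, \<open>d1 = d2 = 0\<close>).
\<close>

definition threshold_shuffle_identity_2 :: bool where
  "threshold_shuffle_identity_2 \<longleftrightarrow>
    (\<forall>\<sigma> \<tau> \<theta> (d1::nat) (d2::nat) t.
      pos_entries \<sigma> \<longrightarrow> pos_entries \<tau> \<longrightarrow> pos_entries \<theta> \<longrightarrow> \<tau> \<noteq> [] \<longrightarrow>
      t = sum_list \<sigma> + sum_list \<tau> + sum_list \<theta> - int d1 - int d2 \<longrightarrow>
      0 = (\<Sum>(\<sigma>1, \<sigma>2)\<in>decomps \<sigma>. \<Sum>(\<tau>1, \<tau>2)\<in>decomps \<tau>. \<Sum>(\<theta>1, \<theta>2)\<in>decomps \<theta>.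
        uri_mult_ext (sum_list \<sigma>2 + sum_list \<tau>1 - int d1) (frag_of \<sigma>2 \<bowtie> signed_rev \<tau>1) *
        uri_mult_ext t
          (frag_of \<sigma>1 \<bowtie> signed_rev \<theta>2
            \<odot> frag_of [sum_list \<sigma>2 + sum_list \<tau>1 - int d1]
            \<odot> frag_of \<tau>2 \<bowtie> signed_rev \<theta>1) +
        uri_mult_ext (sum_list \<tau>2 + sum_list \<theta>1 - int d2) (frag_of \<tau>2 \<bowtie> signed_rev \<theta>1) *
        uri_mult_ext t
          (frag_of \<sigma>1 \<bowtie> signed_rev \<theta>2
            \<odot> frag_of [sum_list \<tau>2 + sum_list \<theta>1 - int d2]
            \<odot> frag_of \<sigma>2 \<bowtie> signed_rev \<tau>1)))"


section \<open>The map \<open>\<triangleright>\<^sub>u\<close>\<close>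

text \<open>The letter \<open>v\<^sub>k\<close> is \<open>Gen k\<close> with \<open>k :: nat\<close>.\<close>

definition ari_binom :: "nat \<Rightarrow> nat \<Rightarrow> nat" where
  "ari_binom k l =
    (if k = 0 \<and> l = 0 then 1 else if k = 0 \<or> l = 0 then 0 else (k - 1) choose (l - 1))"

definition ari_mult :: "nat list \<Rightarrow> nat list \<Rightarrow> int" where
  "ari_mult k l =
    (- 1) ^ (sum_list k + sum_list l) * (\<Prod>(ki, li)\<leftarrow>zip k l. int (ari_binom ki li))"

definition compositions :: "int \<Rightarrow> nat list set" where
  "compositions n = {\<alpha>. (\<forall>x\<in>set \<alpha>. 1 \<le> x) \<and> int (sum_list \<alpha>) = n}"

lemma finite_compositions: "finite (compositions n)"
proof -
  have "length \<alpha> \<le> sum_list \<alpha>" if "\<forall>x\<in>set \<alpha>. 1 \<le> x" for \<alpha> :: "nat list"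
    using that by (induction \<alpha>) auto
  then have "compositions n \<subseteq> {\<alpha>. set \<alpha> \<subseteq> {..nat n} \<and> length \<alpha> \<le> nat n}"
    by (fastforce simp: compositions_def dest: member_le_sum_list)
  then show ?thesis
    by (rule finite_subset) (simp add: finite_lists_length_le)
qed

primrec leaves :: "'v magma \<Rightarrow> 'v list" where
  "leaves (Gen v) = [v]"
| "leaves (s \<star> t) = leaves s @ leaves t"

definition same_bracketing :: "'v magma \<Rightarrow> 'v magma \<Rightarrow> bool" where
  "same_bracketing s t \<longleftrightarrow> rel_magma (\<lambda>_ _. True) s t"

text \<open>
  With \<open>t = t(k)\<close> and \<open>k = leaves t\<close>, the trees \<open>s\<close> with the same bracketing are exactly the
  \<open>t(l)\<close> with \<open>l = leaves s\<close>. Only finitely many have nonzero ari multiplicity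
  (see \<open>finite_ari_trees\<close> below), so restricting to these makes the sum finite.
\<close>

definition ari_trees :: "nat magma \<Rightarrow> nat magma set" where
  "ari_trees t = {s. same_bracketing s t \<and> ari_mult (leaves t) (leaves s) \<noteq> 0}"

definition uri_gen :: "nat magma \<Rightarrow> nat \<Rightarrow> nat magma \<Rightarrow>\<^sub>0 rat" where
  "uri_gen t a =
    (if a = 0 then 0
     else \<Sum>s\<in>ari_trees t. qscale (of_int (ari_mult (leaves t) (leaves s)))
       (\<Sum>\<alpha>\<in>compositions (int a + int (sum_list (leaves t)) - int (sum_list (leaves s))).
          qscale (uri_mult (int a) (map int \<alpha>)) (qof (foldr (\<lambda>i u. Gen i \<star> u) \<alpha> s))))"

primrec uri_tree :: "nat magma \<Rightarrow> nat magma \<Rightarrow> nat magma \<Rightarrow>\<^sub>0 rat" where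
  "uri_tree t (Gen a) = uri_gen t a"
| "uri_tree t (x \<star> y) = mprod (uri_tree t x) (qof y) + mprod (qof x) (uri_tree t y)"

definition uri_magma ::
    "(nat magma \<Rightarrow>\<^sub>0 rat) \<Rightarrow> (nat magma \<Rightarrow>\<^sub>0 rat) \<Rightarrow> nat magma \<Rightarrow>\<^sub>0 rat" where
  "uri_magma = bilin_ext uri_tree"

lemmas uri_magma_simps =
  bilin_ext_qof[of uri_tree, folded uri_magma_def]
  bilin_ext_zero[of uri_tree, folded uri_magma_def]
  bilin_ext_add[of uri_tree, folded uri_magma_def]
  bilin_ext_scale[of uri_tree, folded uri_magma_def]
  bilin_ext_uminus[of uri_tree, folded uri_magma_def]
  bilin_ext_diff[of uri_tree, folded uri_magma_def]


subsection \<open>Descent to the free Lie algebra\<close>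

lemma uri_magma_derivation:
  "uri_magma x (mprod y z) = mprod (uri_magma x y) z + mprod y (uri_magma x z)"
proof (induction x rule: free_rat_induct)
  case (qof t)
  show ?case
  proof (induction y rule: free_rat_induct)
    case (qof u)
    show ?case
      by (induction z rule: free_rat_induct)
        (simp_all add: mprod_simps uri_magma_simps qs.scale_right_distrib)
  qed (simp_all add: mprod_simps uri_magma_simps qs.scale_right_distrib)
qed (simp_all add: mprod_simps uri_magma_simps qs.scale_right_distrib)

lemma uri_magma_ideal_right: "y \<in> lie_ideal \<Longrightarrow> uri_magma x y \<in> lie_ideal"
proof (induction y rule: lie_ideal.induct)
  case (lie_ideal_self y)
  then show ?case
    using lie_ideal_anticomm by (simp add: uri_magma_derivation)
next
  case (lie_ideal_jacobi y z w)
  let ?D = "uri_magma x"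
  let ?J = "\<lambda>y z w. mprod y (mprod z w) + mprod z (mprod w y) + mprod w (mprod y z)"
  have "?J (?D y) z w + ?J y (?D z) w + ?J y z (?D w) \<in> lie_ideal"
    by (intro lie_ideal.lie_ideal_add lie_ideal.lie_ideal_jacobi)
  then show ?case
    by (simp add: uri_magma_simps uri_magma_derivation mprod_simps algebra_simps)
qed (auto simp: uri_magma_simps uri_magma_derivation intro: lie_ideal.intros)

lemma ari_mult_append:
  assumes "length k = length l"
  shows "ari_mult (k @ k') (l @ l') = ari_mult k l * ari_mult k' l'"
  using assms by (simp add: ari_mult_def power_add algebra_simps)

lemma same_bracketing_length: "same_bracketing s t \<Longrightarrow> length (leaves t) = length (leaves s)"
  unfolding same_bracketing_def by (induction s t rule: magma.rel_induct) simp_all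

lemma ari_trees_Gen: "ari_trees (Gen k) = Gen ` {l. ari_binom k l \<noteq> 0}"
proof -
  have "s \<in> ari_trees (Gen k) \<longleftrightarrow> s \<in> Gen ` {l. ari_binom k l \<noteq> 0}" for s
    by (cases s) (auto simp: ari_trees_def same_bracketing_def ari_mult_def)
  then show ?thesis by blast
qed

lemma ari_trees_Star:
  "ari_trees (t \<star> t') = (\<lambda>(s, s'). s \<star> s') ` (ari_trees t \<times> ari_trees t')"
proof -
  have "s \<in> ari_trees (t \<star> t') \<longleftrightarrow> s \<in> (\<lambda>(s, s'). s \<star> s') ` (ari_trees t \<times> ari_trees t')" for s
  proof (cases s)
    case (Star u u')
    have "ari_mult (leaves t @ leaves t') (leaves u @ leaves u') =
        ari_mult (leaves t) (leaves u) * ari_mult (leaves t') (leaves u')"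
      if "same_bracketing u t"
      using same_bracketing_length[OF that] by (rule ari_mult_append)
    then show ?thesis
      unfolding Star by (auto simp: ari_trees_def same_bracketing_def)
  qed (auto simp: ari_trees_def same_bracketing_def)
  then show ?thesis by blast
qed

lemma ari_binom_le: "ari_binom k l \<noteq> 0 \<Longrightarrow> l \<le> k"
  by (auto simp: ari_binom_def split: if_splits)

lemma finite_ari_trees: "finite (ari_trees t)"
proof (induction t)
  case (Gen k)
  have "finite {l. ari_binom k l \<noteq> 0}"
    by (rule finite_subset[of _ "{..k}"]) (use ari_binom_le in auto)
  then show ?case by (simp add: ari_trees_Gen)
qed (simp add: ari_trees_Star)

lemma ari_trees_sum_le: "s \<in> ari_trees t \<Longrightarrow> sum_list (leaves s) \<le> sum_list (leaves t)"
proof (induction t arbitrary: s)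
  case (Gen k)
  then show ?case using ari_binom_le by (auto simp: ari_trees_Gen)
next
  case (Star t t')
  then show ?case by (fastforce simp: ari_trees_Star intro: add_mono)
qed

abbreviation ari_drop :: "nat magma \<Rightarrow> nat magma \<Rightarrow> nat" where
  "ari_drop t s \<equiv> sum_list (leaves t) - sum_list (leaves s)"

definition ari_hom :: "rat \<Rightarrow> nat magma \<Rightarrow> nat magma \<Rightarrow>\<^sub>0 rat" where
  "ari_hom c t = (\<Sum>s\<in>ari_trees t.
    qscale (c ^ ari_drop t s * of_int (ari_mult (leaves t) (leaves s))) (qof s))"

lemma ari_hom_Star: "ari_hom c (t \<star> t') = mprod (ari_hom c t) (ari_hom c t')"
proof -
  let ?w = "\<lambda>t s. c ^ ari_drop t s * of_int (ari_mult (leaves t) (leaves s)) :: rat"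
  have w: "?w (t \<star> t') (s \<star> s') = ?w t s * ?w t' s'"
    if "s \<in> ari_trees t" "s' \<in> ari_trees t'" for s s'
  proof -
    have "ari_mult (leaves t @ leaves t') (leaves s @ leaves s') =
        ari_mult (leaves t) (leaves s) * ari_mult (leaves t') (leaves s')"
      using that(1) by (intro ari_mult_append same_bracketing_length) (simp add: ari_trees_def)
    moreover have "ari_drop (t \<star> t') (s \<star> s') = ari_drop t s + ari_drop t' s'"
      using that[THEN ari_trees_sum_le] by simp
    ultimately show ?thesis by (simp add: power_add)
  qed
  have "ari_hom c (t \<star> t') =
      (\<Sum>(s, s')\<in>ari_trees t \<times> ari_trees t'. qscale (?w (t \<star> t') (s \<star> s')) (qof (s \<star> s')))"
    unfolding ari_hom_def ari_trees_Star
    by (subst sum.reindex) (auto simp: inj_on_def intro!: sum.cong)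
  also have "\<dots> = (\<Sum>(s, s')\<in>ari_trees t \<times> ari_trees t'.
      mprod (qscale (?w t s) (qof s)) (qscale (?w t' s') (qof s')))"
    by (intro sum.cong refl) (clarsimp simp del: leaves.simps simp: w mprod_simps)
  also have "\<dots> = mprod (ari_hom c t) (ari_hom c t')"
    by (simp add: ari_hom_def mprod_sum sum.cartesian_product)
      (simp add: sum.cartesian_product[symmetric] mprod_sum sum.swap[of _ "ari_trees t"])
  finally show ?thesis .
qed

lemma lin_ext_ari_hom_mprod:
  "lin_ext (ari_hom c) (mprod x y) = mprod (lin_ext (ari_hom c) x) (lin_ext (ari_hom c) y)"
proof (induction x rule: free_rat_induct)
  case (qof t)
  show ?case
    by (induction y rule: free_rat_induct)
      (simp_all add: mprod_simps lin_ext_add lin_ext_scale ari_hom_Star)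
qed (simp_all add: mprod_simps lin_ext_add lin_ext_scale)

lemma ari_hom_ideal: "x \<in> lie_ideal \<Longrightarrow> lin_ext (ari_hom c) x \<in> lie_ideal"
  by (induction x rule: lie_ideal.induct)
    (auto simp: lin_ext_add lin_ext_scale lin_ext_ari_hom_mprod intro: lie_ideal.intros)

lemma lie_ideal_interpolation:
  fixes u :: "nat \<Rightarrow> 'v magma \<Rightarrow>\<^sub>0 rat"
  assumes "finite A" "\<And>c. (\<Sum>n\<in>A. qscale (c ^ n) (u n)) \<in> lie_ideal" "n \<in> A"
  shows "u n \<in> lie_ideal"
  using assms
proof (induction A arbitrary: u n rule: finite_induct)
  case (insert N A)
  have *: "u n \<in> lie_ideal" if "n \<in> A" for n
  proof -
    let ?w = "\<lambda>n. qscale (2 ^ n - 2 ^ N) (u n)"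
    have "?w n \<in> lie_ideal"
    proof (rule insert.IH[OF _ that])
      fix c :: rat
      have "(\<Sum>n\<in>insert N A. qscale ((2 * c) ^ n) (u n)) -
          qscale (2 ^ N) (\<Sum>n\<in>insert N A. qscale (c ^ n) (u n)) \<in> lie_ideal"
        by (intro lie_ideal_diff lie_ideal_scale insert.prems(1))
      also have "(\<Sum>n\<in>insert N A. qscale ((2 * c) ^ n) (u n)) -
          qscale (2 ^ N) (\<Sum>n\<in>insert N A. qscale (c ^ n) (u n)) =
          (\<Sum>n\<in>insert N A. qscale (c ^ n) (?w n))"
        by (simp only: qs.scale_sum_right sum_subtractf[symmetric])
          (intro sum.cong refl,
            simp add: power_mult_distrib algebra_simps qs.scale_left_diff_distrib)
      also have "\<dots> = (\<Sum>n\<in>A. qscale (c ^ n) (?w n))"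
        using insert.hyps by simp
      finally show "(\<Sum>n\<in>A. qscale (c ^ n) (?w n)) \<in> lie_ideal" .
    qed
    moreover have "(2 ^ n - 2 ^ N :: rat) \<noteq> 0"
      using insert.hyps that by auto
    ultimately show ?thesis
      using lie_ideal_scale[of "?w n" "inverse (2 ^ n - 2 ^ N)"] by simp
  qed
  show ?case
  proof (cases "n = N")
    case True
    have "(\<Sum>n\<in>insert N A. qscale (1 ^ n) (u n)) - (\<Sum>n\<in>A. u n) \<in> lie_ideal"
      by (intro lie_ideal_diff lie_ideal_sum * insert.prems(1))
    then show ?thesis using insert.hyps True by simp
  qed (use insert.prems * in auto)
qed simp

definition ari_part :: "nat \<Rightarrow> nat magma \<Rightarrow> nat magma \<Rightarrow>\<^sub>0 rat" where
  "ari_part n t = (\<Sum>s\<in>ari_trees t.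
    if ari_drop t s = n then qscale (of_int (ari_mult (leaves t) (leaves s))) (qof s) else 0)"

lemma sum_ari_part:
  assumes "finite A" "\<And>s. s \<in> ari_trees t \<Longrightarrow> ari_drop t s \<in> A"
    and "\<And>n. g n 0 = 0"
    and "\<And>n x y. g n (x + y) = (g n x + g n y :: 'b \<Rightarrow>\<^sub>0 rat)"
  shows "(\<Sum>n\<in>A. g n (ari_part n t)) = (\<Sum>s\<in>ari_trees t.
    g (ari_drop t s) (qscale (of_int (ari_mult (leaves t) (leaves s))) (qof s)))"
proof -
  have gs: "g n (sum f B) = (\<Sum>i\<in>B. g n (f i))" for n B and f :: "nat magma \<Rightarrow> _"
    by (induction B rule: infinite_finite_induct) (auto simp: assms)
  let ?q = "\<lambda>s. qscale (of_int (ari_mult (leaves t) (leaves s))) (qof s)"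
  have "(\<Sum>n\<in>A. g n (ari_part n t)) =
      (\<Sum>s\<in>ari_trees t. \<Sum>n\<in>A. g n (if ari_drop t s = n then ?q s else 0))"
    unfolding ari_part_def gs by (rule sum.swap)
  also have "\<dots> = (\<Sum>s\<in>ari_trees t. \<Sum>n\<in>A. if ari_drop t s = n then g n (?q s) else 0)"
    by (intro sum.cong refl) (simp add: assms)
  also have "\<dots> = (\<Sum>s\<in>ari_trees t. g (ari_drop t s) (?q s))"
    by (intro sum.cong refl) (use assms(1,2) in simp)
  finally show ?thesis .
qed

lemma ari_part_ideal:
  assumes "x \<in> lie_ideal"
  shows "lin_ext (ari_part n) x \<in> lie_ideal"
proof -
  define A where "A = insert n (\<Union>t\<in>Poly_Mapping.keys x. ari_drop t ` ari_trees t)"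
  have A: "finite A" by (simp add: A_def finite_ari_trees)
  show ?thesis
  proof (rule lie_ideal_interpolation[OF A])
    fix c
    have "(\<Sum>n\<in>A. qscale (c ^ n) (lin_ext (ari_part n) x)) =
        (\<Sum>t\<in>Poly_Mapping.keys x. qscale (Poly_Mapping.lookup x t)
          (\<Sum>n\<in>A. qscale (c ^ n) (ari_part n t)))"
      unfolding lin_ext_def qs.scale_sum_right
      by (subst sum.swap) (simp add: mult.commute)
    also have "\<dots> = lin_ext (ari_hom c) x"
      unfolding lin_ext_def
    proof (intro sum.cong refl arg_cong[where f = "qscale _"])
      fix t assume "t \<in> Poly_Mapping.keys x"
      then have "ari_drop t s \<in> A" if "s \<in> ari_trees t" for s
        using that by (auto simp: A_def)
      from sum_ari_part[OF A this, of "\<lambda>n. qscale (c ^ n)"]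
      show "(\<Sum>n\<in>A. qscale (c ^ n) (ari_part n t)) = ari_hom c t"
        by (simp add: ari_hom_def qs.scale_right_distrib)
    qed
    finally show "(\<Sum>n\<in>A. qscale (c ^ n) (lin_ext (ari_part n) x)) \<in> lie_ideal"
      using ari_hom_ideal[OF assms] by simp
  qed (simp add: A_def)
qed

definition uri_graft :: "nat \<Rightarrow> nat \<Rightarrow> nat magma \<Rightarrow> nat magma \<Rightarrow>\<^sub>0 rat" where
  "uri_graft a n s = (\<Sum>\<alpha>\<in>compositions (int a + int n).
    qscale (uri_mult (int a) (map int \<alpha>)) (qof (foldr (\<lambda>i u. Gen i \<star> u) \<alpha> s)))"

lemma graft_ideal:
  "x \<in> lie_ideal \<Longrightarrow> lin_ext (\<lambda>s. qof (foldr (\<lambda>i u. Gen i \<star> u) \<alpha> s)) x \<in> lie_ideal"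
proof (induction \<alpha>)
  case (Cons i \<alpha>)
  have "lin_ext (\<lambda>s. qof (foldr (\<lambda>i u. Gen i \<star> u) (i # \<alpha>) s)) x =
      mprod (qof (Gen i)) (lin_ext (\<lambda>s. qof (foldr (\<lambda>i u. Gen i \<star> u) \<alpha> s)) x)"
    by (induction x rule: free_rat_induct) (simp_all add: lin_ext_add lin_ext_scale mprod_simps)
  with Cons show ?case by (simp add: lie_ideal_left)
qed simp

lemma uri_graft_ideal:
  assumes "x \<in> lie_ideal"
  shows "lin_ext (uri_graft a n) x \<in> lie_ideal"
proof -
  let ?F = "\<lambda>\<alpha> s. qof (foldr (\<lambda>i u. Gen i \<star> u) \<alpha> s)"
  have "lin_ext (uri_graft a n) x = (\<Sum>\<alpha>\<in>compositions (int a + int n).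
      qscale (uri_mult (int a) (map int \<alpha>)) (lin_ext (?F \<alpha>) x))"
    by (induction x rule: free_rat_induct)
      (simp_all add: lin_ext_add lin_ext_scale uri_graft_def sum.distrib qs.scale_right_distrib
        qs.scale_sum_right mult.commute)
  then show ?thesis
    using assms by (auto intro!: lie_ideal_sum lie_ideal_scale graft_ideal)
qed

lemma uri_gen_ideal:
  assumes "x \<in> lie_ideal"
  shows "lin_ext (\<lambda>t. uri_gen t a) x \<in> lie_ideal"
proof (cases "a = 0")
  case True
  then show ?thesis by (simp add: uri_gen_def lin_ext_def lie_ideal_zero)
next
  case a: False
  define A where "A = (\<Union>t\<in>Poly_Mapping.keys x. ari_drop t ` ari_trees t)"
  have A: "finite A" by (simp add: A_def finite_ari_trees)
  have *: "(\<Sum>n\<in>A. lin_ext (uri_graft a n) (ari_part n t)) = uri_gen t a"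
    if t: "t \<in> Poly_Mapping.keys x" for t
  proof -
    have "ari_drop t s \<in> A" if "s \<in> ari_trees t" for s
      using t that by (auto simp: A_def)
    from sum_ari_part[OF A this, of "\<lambda>n. lin_ext (uri_graft a n)"]
    have "(\<Sum>n\<in>A. lin_ext (uri_graft a n) (ari_part n t)) = (\<Sum>s\<in>ari_trees t.
        qscale (of_int (ari_mult (leaves t) (leaves s))) (uri_graft a (ari_drop t s) s))"
      by (simp add: lin_ext_add lin_ext_scale)
    also have "\<dots> = uri_gen t a"
      using a unfolding uri_gen_def uri_graft_def
      by (simp add: of_nat_diff ari_trees_sum_le algebra_simps)
    finally show ?thesis .
  qed
  have "lin_ext (\<lambda>t. uri_gen t a) x =
      (\<Sum>n\<in>A. lin_ext (uri_graft a n) (lin_ext (ari_part n) x))"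
    unfolding lin_ext_def[of _ x] lin_ext_sum lin_ext_scale
    by (subst sum.swap) (simp add: *[symmetric] qs.scale_sum_right)
  then show ?thesis
    using assms by (auto intro!: lie_ideal_sum uri_graft_ideal ari_part_ideal)
qed

lemma uri_magma_ideal_left:
  assumes "x \<in> lie_ideal"
  shows "uri_magma x y \<in> lie_ideal"
proof (induction y rule: free_rat_induct)
  case (qof t)
  show ?case
  proof (induction t)
    case (Gen a)
    have "uri_magma x (qof (Gen a)) = lin_ext (\<lambda>t. uri_gen t a) x"
      by (simp add: uri_magma_def bilin_ext_def)
    then show ?case using uri_gen_ideal[OF assms] by simp
  next
    case (Star s t)
    have "uri_magma x (qof (s \<star> t)) =
        mprod (uri_magma x (qof s)) (qof t) + mprod (qof s) (uri_magma x (qof t))"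
      using uri_magma_derivation[of x "qof s" "qof t"] by (simp add: mprod_simps)
    with Star show ?case by (simp add: lie_ideal.intros)
  qed
qed (simp_all add: uri_magma_simps lie_ideal.intros)

lift_definition uri_tri :: "nat free_lie \<Rightarrow> nat free_lie \<Rightarrow> nat free_lie" is uri_magma
proof -
  fix x x' y y' :: "nat magma \<Rightarrow>\<^sub>0 rat"
  assume "x - x' \<in> lie_ideal" "y - y' \<in> lie_ideal"
  then have "uri_magma (x - x') y + uri_magma x' (y - y') \<in> lie_ideal"
    by (intro lie_ideal_add uri_magma_ideal_left uri_magma_ideal_right)
  then show "uri_magma x y - uri_magma x' y' \<in> lie_ideal"
    by (simp add: uri_magma_simps)
qed

end

theory Submission
  imports Defs
begin

text \<open>
  Let \<open>D\<^sub>n\<close> (\<open>hasse n\<close> below) be the part of the ari map lowering the weight by \<open>n\<close>; then \<open>D\<^sub>n = D\<^sup>n / n!\<close> for the derivation \<open>D v\<^sub>k = - (k - 1) v\<^bsub>k-1\<^esub>\<close>, and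
  \<open>x \<triangleright> v\<^sub>a = \<Sum>\<^sub>n P\<^bsub>a,n\<^esub> (D\<^sub>n x)\<close>, where \<open>P\<^bsub>a,n\<^esub>\<close> (\<open>uri_word a n\<close>) is the sum over compositions \<open>\<alpha>\<close> of
  \<open>a + n\<close> of \<open>\<mu>\<^bsub>a,\<alpha>\<^esub>\<close> times the iterated adjoint action of \<open>v\<^bsub>\<alpha>1\<^esub>, v\<^bsub>\<alpha>2\<^esub>, \<dots>\<close>. Incrementing the
  parts of a composition shows \<open>[D, P\<^bsub>a,n\<^esub>] = - (a - 1) P\<^bsub>a-1,n\<^esub> - n P\<^bsub>a,n-1\<^esub>\<close>, so that
  \<open>D (x \<triangleright> y) = x \<triangleright> D y\<close>. Hence in \<open>x \<triangleright> (y \<triangleright> v\<^sub>a) - (x \<triangleright> y) \<triangleright> v\<^sub>a\<close> only the terms survive in which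
  \<open>x\<close> acts on a letter of \<open>P\<^bsub>a,j\<^esub>\<close>. Expanding \<open>P\<^bsub>a,i+j\<^esub> [D\<^sub>i x, D\<^sub>j y]\<close> by the Leibniz rule into
  brackets of words acting on \<open>D\<^sub>i x\<close> and words acting on \<open>D\<^sub>j y\<close>, the post-Lie identity at a letter
  becomes, coefficient by coefficient, the first threshold shuffle identity with \<open>d\<^sub>1 = i\<close>, \<open>d\<^sub>2 = j\<close>.
  Both sides of the post-Lie identity are derivations in the last argument.
\<close>

section \<open>The free Lie algebra and its lowering operators\<close>

interpretation fl: vector_space free_lie_scale
  by standard (transfer; simp add: algebra_simps lie_ideal_zero qs.scale_right_distrib qs.scale_left_distrib)+

lemmas free_lie_abs_simps =
  plus_free_lie.abs_eq[symmetric] free_lie_scale.abs_eq[symmetric]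
  free_lie_bracket.abs_eq[symmetric] zero_free_lie.abs_eq[symmetric]

lemma lie_algebra_free_lie: "lie_algebra free_lie_scale (free_lie_bracket :: 'v free_lie \<Rightarrow> _)"
proof unfold_locales
  fix x y z :: "'v free_lie"
  show "free_lie_bracket x x = 0"
    by transfer (simp add: lie_ideal_self)
  show "free_lie_bracket x (free_lie_bracket y z) + free_lie_bracket y (free_lie_bracket z x) +
      free_lie_bracket z (free_lie_bracket x y) = 0"
    by transfer (simp add: lie_ideal_jacobi)
qed (transfer; simp add: mprod_simps lie_ideal_zero)+

interpretation fl: lie_algebra free_lie_scale free_lie_bracket
  by (rule lie_algebra_free_lie)

definition letter :: "'v \<Rightarrow> 'v free_lie" where
  "letter k = abs_free_lie (qof (Gen k))"

lemma free_lie_induct [case_names zero add scale letter bracket]: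
  assumes "P 0" "\<And>x y. P x \<Longrightarrow> P y \<Longrightarrow> P (x + y)" "\<And>c x. P x \<Longrightarrow> P (free_lie_scale c x)"
    and "\<And>k. P (letter k)" "\<And>x y. P x \<Longrightarrow> P y \<Longrightarrow> P (free_lie_bracket x y)"
  shows "P x"
proof -
  have *: "P (abs_free_lie (qof t))" for t
  proof (induction t)
    case (Star s t)
    have "abs_free_lie (qof (s \<star> t)) =
        free_lie_bracket (abs_free_lie (qof s)) (abs_free_lie (qof t))"
      by (simp add: free_lie_bracket.abs_eq mprod_simps)
    with Star show ?case using assms(5) by simp
  qed (use assms(4) in \<open>simp add: letter_def\<close>)
  have "P (abs_free_lie X)" for X
    by (induction X rule: free_rat_induct)
      (use assms * in \<open>simp_all add: plus_free_lie.abs_eq[symmetric]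
        free_lie_scale.abs_eq[symmetric] zero_free_lie_def[symmetric]\<close>)
  then show ?thesis
    by (induction x rule: free_lie.abs_induct) simp
qed

section \<open>Components of the ari map as a Hasse-Schmidt derivation\<close>

lift_definition hasse :: "nat \<Rightarrow> nat free_lie \<Rightarrow> nat free_lie" is "\<lambda>n. lin_ext (ari_part n)"
  by (simp only: lin_ext_diff[symmetric] ari_part_ideal)

lemma hasse_zero [simp]: "hasse n 0 = 0"
  and hasse_add: "hasse n (x + y) = hasse n x + hasse n y"
  and hasse_scale: "hasse n (free_lie_scale c x) = free_lie_scale c (hasse n x)"
  by (transfer; simp add: lin_ext_add lin_ext_scale lie_ideal_zero)+

lemma hasse_letter:
  "hasse n (letter k) =
    (if n \<le> k then free_lie_scale ((- 1) ^ n * of_nat (ari_binom k (k - n))) (letter (k - n)) else 0)"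
proof -
  have "ari_part n (Gen k) = (\<Sum>l | ari_binom k l \<noteq> 0.
      if k - l = n then qscale (of_int (ari_mult [k] [l])) (qof (Gen l)) else 0)"
    unfolding ari_part_def ari_trees_Gen by (subst sum.reindex) (auto simp: inj_on_def cong: if_cong)
  also have "\<dots> = (\<Sum>l\<in>{..k}.
      if k - l = n then qscale (of_int (ari_mult [k] [l])) (qof (Gen l)) else 0)"
    using ari_binom_le by (intro sum.mono_neutral_left) (auto simp: ari_mult_def)
  also have "\<dots> = (\<Sum>l\<in>{..k}. if l = k - n then
      (if n \<le> k then qscale (of_int (ari_mult [k] [k - n])) (qof (Gen (k - n))) else 0) else 0)"
    by (intro sum.cong) auto
  also have "\<dots> = (if n \<le> k then qscale (of_int (ari_mult [k] [k - n])) (qof (Gen (k - n))) else 0)"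
    by simp
  also have "\<dots> = (if n \<le> k then
      qscale ((- 1) ^ n * of_nat (ari_binom k (k - n))) (qof (Gen (k - n))) else 0)"
  proof -
    \<comment> \<open>The sign exponent k + (k - n) of \<open>ari_mult\<close> has the parity of
      n.\<close>
    have "(- 1) ^ (k + (k - n)) = ((- 1) ^ n :: rat)" if "n \<le> k"
      using that by (auto simp: minus_one_power_iff)
    then show ?thesis by (auto simp: ari_mult_def)
  qed
  finally show ?thesis
    by (simp add: letter_def hasse.abs_eq free_lie_abs_simps split: if_splits)
qed

lemma mprod_if: "mprod (if b then x else 0) (if c then y else 0) = (if b \<and> c then mprod x y else 0)"
  by (simp add: mprod_simps)

text \<open>Weight drops add and ari multiplicities multiply over the two subtrees, so a total drop
  n is distributed as i on the left and n - i on the right.\<close>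

lemma ari_part_Star: "ari_part n (t \<star> t') = (\<Sum>i\<le>n. mprod (ari_part i t) (ari_part (n - i) t'))"
proof -
  let ?m = "\<lambda>t s. of_int (ari_mult (leaves t) (leaves s)) :: rat"
  have m: "?m (t \<star> t') (s \<star> s') = ?m t s * ?m t' s'"
    and d: "ari_drop (t \<star> t') (s \<star> s') = ari_drop t s + ari_drop t' s'"
    if "s \<in> ari_trees t" "s' \<in> ari_trees t'" for s s'
  proof -
    show "?m (t \<star> t') (s \<star> s') = ?m t s * ?m t' s'"
      using that(1) ari_mult_append[of "leaves t" "leaves s"]
      by (simp add: ari_trees_def same_bracketing_length)
    show "ari_drop (t \<star> t') (s \<star> s') = ari_drop t s + ari_drop t' s'"
      using that[THEN ari_trees_sum_le] by simp
  qed
  have "ari_part n (t \<star> t') = (\<Sum>(s, s')\<in>ari_trees t \<times> ari_trees t'.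
      if ari_drop (t \<star> t') (s \<star> s') = n then qscale (?m (t \<star> t') (s \<star> s')) (qof (s \<star> s')) else 0)"
    unfolding ari_part_def ari_trees_Star
    by (subst sum.reindex) (auto simp: inj_on_def intro!: sum.cong)
  also have "\<dots> = (\<Sum>(s, s')\<in>ari_trees t \<times> ari_trees t'. \<Sum>i\<le>n.
      mprod (if ari_drop t s = i then qscale (?m t s) (qof s) else 0)
        (if ari_drop t' s' = n - i then qscale (?m t' s') (qof s') else 0))"
  proof (intro sum.cong refl, clarify)
    fix s s' assume s: "s \<in> ari_trees t" "s' \<in> ari_trees t'"
    \<comment> \<open>For a fixed pair of subtrees only i equal to the drop of \<open>s\<close> can
      contribute.\<close>
    have "(\<Sum>i\<le>n. mprod (if ari_drop t s = i then qscale (?m t s) (qof s) else 0)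
        (if ari_drop t' s' = n - i then qscale (?m t' s') (qof s') else 0)) =
        (\<Sum>i\<le>n. if i = ari_drop t s then (if ari_drop t s \<le> n \<and> ari_drop t' s' = n - ari_drop t s then
          qscale (?m t s * ?m t' s') (qof (s \<star> s')) else 0) else 0)"
      unfolding mprod_if by (intro sum.cong) (auto simp: mprod_simps)
    also have "\<dots> = (if ari_drop (t \<star> t') (s \<star> s') = n then
          qscale (?m (t \<star> t') (s \<star> s')) (qof (s \<star> s')) else 0)"
      unfolding m[OF s] d[OF s] by (simp only: sum.delta finite_atMost) (simp; linarith)
    finally show "(if ari_drop (t \<star> t') (s \<star> s') = n then
          qscale (?m (t \<star> t') (s \<star> s')) (qof (s \<star> s')) else 0) =
        (\<Sum>i\<le>n. mprod (if ari_drop t s = i then qscale (?m t s) (qof s) else 0)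
        (if ari_drop t' s' = n - i then qscale (?m t' s') (qof s') else 0))" ..
  qed
  also have "\<dots> = (\<Sum>i\<le>n. \<Sum>(s, s')\<in>ari_trees t \<times> ari_trees t'.
      mprod (if ari_drop t s = i then qscale (?m t s) (qof s) else 0)
        (if ari_drop t' s' = n - i then qscale (?m t' s') (qof s') else 0))"
    by (simp only: case_prod_unfold) (rule sum.swap)
  also have "\<dots> = (\<Sum>i\<le>n. mprod (ari_part i t) (ari_part (n - i) t'))"
    unfolding ari_part_def mprod_sum sum.cartesian_product[symmetric]
    by (rule sum.cong[OF refl]) (rule sum.swap)
  finally show ?thesis .
qed

lemma lin_ext_ari_part_mprod:
  "lin_ext (ari_part n) (mprod x y) =
    (\<Sum>i\<le>n. mprod (lin_ext (ari_part i) x) (lin_ext (ari_part (n - i)) y))"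
proof (induction x rule: free_rat_induct)
  case (qof t)
  show ?case
    by (induction y rule: free_rat_induct)
      (simp_all add: mprod_simps lin_ext_add lin_ext_scale ari_part_Star sum.distrib qs.scale_sum_right)
qed (simp_all add: mprod_simps lin_ext_add lin_ext_scale sum.distrib qs.scale_sum_right)

lemma abs_free_lie_sum: "abs_free_lie (sum f A) = (\<Sum>i\<in>A. abs_free_lie (f i))"
  by (induction A rule: infinite_finite_induct) (simp_all add: free_lie_abs_simps)

lemma hasse_bracket:
  "hasse n (free_lie_bracket x y) = (\<Sum>i\<le>n. free_lie_bracket (hasse i x) (hasse (n - i) y))"
proof -
  have "hasse n (free_lie_bracket (abs_free_lie X) (abs_free_lie Y)) =
      (\<Sum>i\<le>n. free_lie_bracket (hasse i (abs_free_lie X)) (hasse (n - i) (abs_free_lie Y)))" for X Y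
    by (simp add: hasse.abs_eq free_lie_bracket.abs_eq lin_ext_ari_part_mprod abs_free_lie_sum)
  then show ?thesis
    by (induction x rule: free_lie.abs_induct, induction y rule: free_lie.abs_induct) simp
qed

section \<open>Bracket calculus, local nilpotency and divided powers\<close>

abbreviation br :: "'v free_lie \<Rightarrow> 'v free_lie \<Rightarrow> 'v free_lie" where
  "br \<equiv> free_lie_bracket"

notation free_lie_scale (infixr \<open>\<cdot>\<close> 75)

lemma br_add: "br (x + y) z = br x z + br y z" "br z (x + y) = br z x + br z y"
  and br_scale: "br (c \<cdot> x) z = c \<cdot> br x z" "br z (c \<cdot> x) = c \<cdot> br z x"
  and br_zero [simp]: "br 0 z = 0" "br z 0 = 0"
  by (transfer; simp add: mprod_simps lie_ideal_zero)+

lemma br_sum: "br (sum f A) z = (\<Sum>i\<in>A. br (f i) z)" "br z (sum f A) = (\<Sum>i\<in>A. br z (f i))"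
  by (induction A rule: infinite_finite_induct) (simp_all add: br_add)

lemma br_anticomm: "br x y = - br y x"
proof -
  have "0 = br (x + y) (x + y)" by (simp only: fl.br_self)
  also have "\<dots> = br x y + br y x"
    by (simp only: br_add) (simp add: fl.br_self)
  finally show ?thesis by (metis eq_neg_iff_add_eq_0)
qed

lemma br_uminus: "br (- x) y = - br x y" "br x (- y) = - br x y"
  using br_scale(1)[of "-1" x y] br_scale(2)[of x "-1" y] by simp_all

lemma br_diff: "br x (y - z) = br x y - br x z" "br (x - y) z = br x z - br y z"
  using br_add(2)[of x y "- z"] br_add(1)[of x "- y" z] by (simp_all add: br_uminus)

lemma br_leibniz: "br x (br y z) = br (br x y) z + br y (br x z)"
proof -
  have "br x (br y z) = - br y (br z x) - br z (br x y)"
    using fl.br_jacobi[of x y z] by (simp add: algebra_simps eq_neg_iff_add_eq_0)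
  then show ?thesis
    using br_anticomm[of z x] br_anticomm[of z "br x y"] by (simp add: br_uminus)
qed

lemma hasse_sum: "hasse n (sum f A) = (\<Sum>i\<in>A. hasse n (f i))"
  by (induction A rule: infinite_finite_induct) (simp_all add: hasse_add)

text \<open>Each letter can be lowered only finitely often. The bound makes the sum over n in the
  action on a letter finite.\<close>

lemma hasse_nilpotent: "\<exists>N. \<forall>n\<ge>N. hasse n x = 0"
proof (induction x rule: free_lie_induct)
  case (add x y)
  then obtain M N where "\<forall>n\<ge>M. hasse n x = 0" "\<forall>n\<ge>N. hasse n y = 0" by blast
  then show ?case by (intro exI[of _ "max M N"]) (simp add: hasse_add)
next
  case (letter k)
  show ?case by (intro exI[of _ "Suc k"]) (simp add: hasse_letter)
next
  case (bracket x y)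
  then obtain M N where MN: "\<forall>n\<ge>M. hasse n x = 0" "\<forall>n\<ge>N. hasse n y = 0" by blast
  have "br (hasse i x) (hasse (n - i) y) = 0" if "n \<ge> M + N" "i \<le> n" for n i
    using MN that by (cases "i \<ge> M") auto
  then show ?case by (intro exI[of _ "M + N"]) (simp add: hasse_bracket)
qed (auto simp: hasse_scale)

lemma hasse_0 [simp]: "hasse 0 x = x"
proof (induction x rule: free_lie_induct)
  case (letter k)
  show ?case by (simp add: hasse_letter ari_binom_def)
qed (simp_all add: hasse_add hasse_scale hasse_bracket)

lemma hasse_1_bracket: "hasse 1 (br x y) = br (hasse 1 x) y + br x (hasse 1 y)"
  by (simp add: hasse_bracket add.commute)

lemma hasse_1_letter: "hasse 1 (letter k) = (- of_nat (k - 1)) \<cdot> letter (k - 1)"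
proof (cases k)
  case (Suc m)
  then show ?thesis by (cases m) (simp_all add: hasse_letter ari_binom_def)
qed (simp add: hasse_letter)

text \<open>This makes \<open>hasse n\<close> the divided power \<open>D^n / n!\<close> of the
  derivation D = \<open>hasse 1\<close>, so that commutation has to be verified for D alone. On
  letters it is the absorption identity for binomials, on brackets the Leibniz rule.\<close>

lemma hasse_Suc: "of_nat (Suc n) \<cdot> hasse (Suc n) x = hasse 1 (hasse n x)"
proof (induction x arbitrary: n rule: free_lie_induct)
  case (letter k)
  show ?case
  proof (cases "Suc n < k")
    case True
    then obtain m where k: "k = Suc (Suc (n + m))" by (auto simp: less_iff_Suc_add)
    have "Suc n * (Suc (n + m) choose m) = Suc m * (Suc (n + m) choose Suc m)"
      using Suc_times_binomial_add[of m n] by (simp add: add.commute)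
    then have "of_nat (Suc n) * of_nat (Suc (n + m) choose m) =
        (of_nat (Suc m) * of_nat (Suc (n + m) choose Suc m) :: rat)"
      by (metis of_nat_mult)
    moreover have "hasse n (letter k) =
          ((- 1) ^ n * of_nat (Suc (n + m) choose Suc m)) \<cdot> letter (Suc (Suc m))"
        "hasse (Suc n) (letter k) =
          ((- 1) ^ Suc n * of_nat (Suc (n + m) choose m)) \<cdot> letter (Suc m)"
      by (simp_all add: hasse_letter ari_binom_def k)
    ultimately show ?thesis
      by (simp add: hasse_1_letter hasse_scale mult.left_commute
          del: of_nat_Suc binomial_Suc_Suc One_nat_def)
  next
    case False
    \<comment> \<open>Both sides vanish, because lowering stops at the letters of index 0 and
      1.\<close>
    then show ?thesis
      by (auto simp: hasse_letter hasse_scale ari_binom_def)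
  qed
next
  case (bracket x y)
  let ?g = "\<lambda>i. br (hasse i x) (hasse (Suc n - i) y)"
  \<comment> \<open>The summand \<open>?g i\<close> arises from i - 1 with factor i and from i with
    factor Suc n - i; the two factors add up to Suc n.\<close>
  have "hasse 1 (hasse n (br x y)) =
      (\<Sum>i\<le>n. of_nat (Suc i) \<cdot> ?g (Suc i)) + (\<Sum>i\<le>n. of_nat (Suc n - i) \<cdot> ?g i)"
    unfolding hasse_bracket[of n] hasse_sum hasse_1_bracket bracket[symmetric] br_scale sum.distrib
    by (intro arg_cong2[of _ _ _ _ "(+)"] sum.cong) (auto simp: Suc_diff_le)
  also have "(\<Sum>i\<le>n. of_nat (Suc i) \<cdot> ?g (Suc i)) = (\<Sum>i\<le>Suc n. of_nat i \<cdot> ?g i)"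
    by (subst sum.atMost_Suc_shift) simp
  also have "(\<Sum>i\<le>n. of_nat (Suc n - i) \<cdot> ?g i) = (\<Sum>i\<le>Suc n. of_nat (Suc n - i) \<cdot> ?g i)"
    by simp
  also have "(\<Sum>i\<le>Suc n. of_nat i \<cdot> ?g i) + (\<Sum>i\<le>Suc n. of_nat (Suc n - i) \<cdot> ?g i) =
      (\<Sum>i\<le>Suc n. of_nat (Suc n) \<cdot> ?g i)"
    unfolding sum.distrib[symmetric] fl.scale_left_distrib[symmetric] of_nat_add[symmetric]
    by (intro sum.cong) auto
  finally show ?case by (simp only: hasse_bracket fl.scale_sum_right)
next
  case (scale c x)
  show ?case by (simp only: hasse_scale fl.scale_left_commute[of _ c] scale)
qed (simp_all add: hasse_add fl.scale_right_distrib)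

section \<open>Adjoint words and the action on a letter\<close>

definition ad_word :: "'v list \<Rightarrow> 'v free_lie \<Rightarrow> 'v free_lie" where
  "ad_word \<alpha> x = foldr (\<lambda>i. br (letter i)) \<alpha> x"

lemma ad_word_simps [simp]:
  "ad_word [] x = x"
  "ad_word (i # \<alpha>) x = br (letter i) (ad_word \<alpha> x)"
  "ad_word (\<alpha> @ \<beta>) x = ad_word \<alpha> (ad_word \<beta> x)"
  "ad_word \<alpha> 0 = 0"
  by (simp add: ad_word_def, simp add: ad_word_def, simp add: ad_word_def)
    (induction \<alpha>, simp_all add: ad_word_def)

lemma ad_word_add: "ad_word \<alpha> (x + y) = ad_word \<alpha> x + ad_word \<alpha> y"
  and ad_word_scale: "ad_word \<alpha> (c \<cdot> x) = c \<cdot> ad_word \<alpha> x"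
  by (induction \<alpha>) (simp_all add: br_add br_scale)

lemma ad_word_sum: "ad_word \<alpha> (sum f A) = (\<Sum>i\<in>A. ad_word \<alpha> (f i))"
  by (induction A rule: infinite_finite_induct) (simp_all add: ad_word_add)

definition mu :: "nat \<Rightarrow> nat list \<Rightarrow> rat" where
  "mu a \<alpha> = uri_mult (int a) (map int \<alpha>)"

definition uri_word :: "nat \<Rightarrow> nat \<Rightarrow> nat free_lie \<Rightarrow> nat free_lie" where
  "uri_word a n x = (\<Sum>\<alpha>\<in>compositions (int (a + n)). mu a \<alpha> \<cdot> ad_word \<alpha> x)"

lemma uri_word_zero [simp]: "uri_word a n 0 = 0"
  and uri_word_add: "uri_word a n (x + y) = uri_word a n x + uri_word a n y"
  and uri_word_scale: "uri_word a n (c \<cdot> x) = c \<cdot> uri_word a n x"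
  by (simp_all add: uri_word_def ad_word_add ad_word_scale fl.scale_right_distrib sum.distrib
    fl.scale_sum_right mult.commute)

lemma abs_uri_graft: "abs_free_lie (lin_ext (uri_graft a n) X) = uri_word a n (abs_free_lie X)"
proof (induction X rule: free_rat_induct)
  case (qof t)
  have "abs_free_lie (qof (foldr (\<lambda>i u. Gen i \<star> u) \<alpha> t)) = ad_word \<alpha> (abs_free_lie (qof t))" for \<alpha>
  proof (induction \<alpha>)
    case (Cons i \<alpha>)
    have "qof (Gen i \<star> u) = mprod (qof (Gen i)) (qof u)" for u :: "nat magma"
      by (simp add: mprod_simps)
    with Cons show ?case by (simp add: free_lie_abs_simps letter_def)
  qed simp
  then show ?case
    by (simp add: uri_graft_def uri_word_def abs_free_lie_sum free_lie_abs_simps mu_def)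
qed (simp_all add: lin_ext_add lin_ext_scale free_lie_abs_simps uri_word_add uri_word_scale)

text \<open>Ari trees are grouped by their weight drop: all trees of drop n share the same
  compositions, so their contribution factors as \<open>uri_word a n\<close> after
  \<open>hasse n\<close>.\<close>

lemma uri_tri_letter:
  assumes "a \<ge> 1" and N: "\<forall>n\<ge>N. hasse n x = 0"
  shows "uri_tri x (letter a) = (\<Sum>n<N. uri_word a n (hasse n x))"
proof -
  obtain X where x: "x = abs_free_lie X"
    by (induction x rule: free_lie.abs_induct) blast
  \<comment> \<open>The representative X may have ari trees of drop N or more although
    \<open>hasse n x\<close> vanishes there in the quotient. A covers these drops as well, and the
    surplus terms are 0.\<close>
  define A where "A = {..<N} \<union> (\<Union>t\<in>Poly_Mapping.keys X. ari_drop t ` ari_trees t)"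
  have A: "finite A" by (simp add: A_def finite_ari_trees)
  have *: "(\<Sum>n\<in>A. lin_ext (uri_graft a n) (ari_part n t)) = uri_gen t a"
    if t: "t \<in> Poly_Mapping.keys X" for t
  proof -
    have "ari_drop t s \<in> A" if "s \<in> ari_trees t" for s
      using t that by (auto simp: A_def)
    from sum_ari_part[OF A this, of "\<lambda>n. lin_ext (uri_graft a n)"] show ?thesis
      using assms(1) unfolding uri_gen_def uri_graft_def
      by (simp add: lin_ext_add lin_ext_scale uri_graft_def of_nat_diff ari_trees_sum_le algebra_simps)
  qed
  have "uri_magma X (qof (Gen a)) = (\<Sum>n\<in>A. lin_ext (uri_graft a n) (lin_ext (ari_part n) X))"
    unfolding uri_magma_def bilin_ext_def lin_ext_def[of _ X] lin_ext_sum lin_ext_scale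
    by (subst sum.swap) (simp add: *[symmetric] qs.scale_sum_right)
  then have "uri_tri x (letter a) = (\<Sum>n\<in>A. uri_word a n (hasse n x))"
    by (simp add: x letter_def uri_tri.abs_eq abs_free_lie_sum abs_uri_graft hasse.abs_eq)
  also have "\<dots> = (\<Sum>n<N. uri_word a n (hasse n x))"
    using A N by (intro sum.mono_neutral_right) (auto simp: A_def not_less)
  finally show ?thesis .
qed

section \<open>Incrementing a part of a composition\<close>

text \<open>The hypothesis \<open>1 \<le> a\<close> rules out the empty prefix, whose sum 0 would
  otherwise give index 0.\<close>

lemma threshold_ind_Cons:
  assumes "1 \<le> a" "a \<le> b + sum_list \<beta>"
  shows "threshold_ind a (b # \<beta>) = (if a \<le> b then 1 else Suc (threshold_ind (a - b) \<beta>))"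
proof (cases "a \<le> b")
  case True
  then have "(LEAST j. j \<le> Suc (length \<beta>) \<and> a \<le> sum_list (take j (b # \<beta>))) = 1"
    using assms by (intro Least_equality) (auto simp: not_less_eq_eq[symmetric] intro: Suc_leI gr0I)
  with True assms show ?thesis by (simp add: threshold_ind_def)
next
  case False
  let ?P = "\<lambda>j. j \<le> length (b # \<beta>) \<and> a \<le> sum_list (take j (b # \<beta>))"
  have "(LEAST j. ?P j) = Suc (LEAST j. ?P (Suc j))"
    by (rule Least_Suc[of _ "length (b # \<beta>)"]) (use assms in auto)
  moreover have "(\<lambda>j. ?P (Suc j)) = (\<lambda>j. j \<le> length \<beta> \<and> a - b \<le> sum_list (take j \<beta>))"
    by (auto simp: fun_eq_iff)
  ultimately show ?thesis
    using False assms by (auto simp: threshold_ind_def)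
qed

lemma threshold_ind_nonpos: "a \<le> 0 \<Longrightarrow> threshold_ind a \<alpha> = 0"
  by (auto simp: threshold_ind_def intro!: Least_equality)

definition nthreshold :: "nat \<Rightarrow> nat list \<Rightarrow> nat" where
  "nthreshold a \<alpha> = threshold_ind (int a) (map int \<alpha>)"

lemma sum_list_int: "sum_list (map int \<alpha>) = int (sum_list \<alpha>)"
  by (induction \<alpha>) auto

lemma nthreshold_Cons:
  assumes "1 \<le> a" "a \<le> b + sum_list \<beta>"
  shows "nthreshold a (b # \<beta>) = (if a \<le> b then 1 else Suc (nthreshold (a - b) \<beta>))"
  using threshold_ind_Cons[of "int a" "int b" "map int \<beta>"] assms
  by (auto simp: nthreshold_def sum_list_int of_nat_diff)

text \<open>If some prefix sums to a - 1, incrementing a part inside it (total weight a - 1) yields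
  the index for a - 1, and incrementing a later part yields the index for a. If no prefix does, both
  indices agree and every increment yields this common value.\<close>

lemma sum_nthreshold_increment:
  fixes g :: "nat \<Rightarrow> rat"
  assumes "1 \<le> a" "a \<le> Suc (sum_list \<beta>)" "\<forall>x\<in>set \<beta>. 1 \<le> x"
  shows "(\<Sum>i<length \<beta>. of_nat (\<beta> ! i) * g (nthreshold a (\<beta>[i := Suc (\<beta> ! i)]))) =
    of_nat (a - 1) * g (nthreshold (a - 1) \<beta>) +
    of_nat (Suc (sum_list \<beta>) - a) * g (nthreshold a \<beta>)"
  using assms
proof (induction \<beta> arbitrary: a g)
  case (Cons b \<beta>)
  have upd: "sum_list (\<beta>[i := Suc (\<beta> ! i)]) = Suc (sum_list \<beta>)" if "i < length \<beta>" for i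
    using that by (simp add: sum_list_update elem_le_sum_list)
  have sum_nth: "(\<Sum>i<length \<beta>. rat_of_nat (\<beta> ! i)) = of_nat (sum_list \<beta>)"
    by (simp add: sum_list_sum_nth lessThan_atLeast0)
  have "(\<Sum>i<length (b # \<beta>). of_nat ((b # \<beta>) ! i) * g (nthreshold a ((b # \<beta>)[i := Suc ((b # \<beta>) ! i)]))) =
    of_nat b * g (nthreshold a (Suc b # \<beta>)) +
    (\<Sum>i<length \<beta>. of_nat (\<beta> ! i) * g (if a \<le> b then 1 else Suc (nthreshold (a - b) (\<beta>[i := Suc (\<beta> ! i)]))))"
    using Cons.prems
    by (simp only: list.size add_0_right add_Suc_right sum.lessThan_Suc_shift)
       (simp add: nthreshold_Cons upd)
  also have "\<dots> = of_nat (a - 1) * g (nthreshold (a - 1) (b # \<beta>)) +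
    of_nat (Suc (sum_list (b # \<beta>)) - a) * g (nthreshold a (b # \<beta>))"
  proof (cases "a \<le> b")
    case True
    have "of_nat (a - 1) * g (nthreshold (a - 1) (b # \<beta>)) = of_nat (a - 1) * g 1"
    proof (cases "a = 1")
      case False
      then have "nthreshold (a - 1) (b # \<beta>) = 1"
        by (subst nthreshold_Cons) (use True Cons.prems in auto)
      then show ?thesis by (simp only:)
    qed simp
    moreover have "nthreshold a (b # \<beta>) = 1" "nthreshold a (Suc b # \<beta>) = 1"
      using True Cons.prems by (simp_all add: nthreshold_Cons)
    moreover have "rat_of_nat (a - 1) + of_nat (Suc (sum_list (b # \<beta>)) - a) =
        of_nat b + of_nat (sum_list \<beta>)"
      using True Cons.prems by (simp flip: of_nat_add)
    ultimately show ?thesis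
      using True by (simp only: sum_nth sum_distrib_right[symmetric] distrib_right[symmetric] if_True)
  next
    case False
    \<comment> \<open>Removing the first part lowers the threshold by b and shifts the index by one;
      the shift is absorbed into g.\<close>
    note IH = Cons.IH[of "a - b" "\<lambda>j. g (Suc j)"]
    have *: "(\<Sum>i<length \<beta>. of_nat (\<beta> ! i) * g (Suc (nthreshold (a - b) (\<beta>[i := Suc (\<beta> ! i)])))) =
      of_nat (a - b - 1) * g (Suc (nthreshold (a - b - 1) \<beta>)) +
      of_nat (Suc (sum_list \<beta>) - (a - b)) * g (Suc (nthreshold (a - b) \<beta>))"
      using False Cons.prems by (intro IH) auto
    \<comment> \<open>At the top value \<open>a = Suc (b + sum_list \<beta>)\<close> the indices
      take their default 0 and the recursion fails, but both coefficients are 0.\<close>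
    have 1: "of_nat (Suc (sum_list \<beta>) - (a - b)) * g (Suc (nthreshold (a - b) \<beta>)) =
        of_nat (Suc (sum_list (b # \<beta>)) - a) * g (nthreshold a (b # \<beta>))"
      using False Cons.prems
      by (cases "a = Suc (b + sum_list \<beta>)") (auto simp: nthreshold_Cons)
    have b: "1 \<le> b" using Cons.prems by simp
    show ?thesis
    \<comment> \<open>For a = Suc b the remaining threshold a - b - 1 is 0, and so is its
      coefficient.\<close>
    proof (cases "a = Suc b")
      case True
      with * 1 b show ?thesis by (simp add: nthreshold_Cons)
    next
      case ne: False
      have "of_nat (a - 1) * g (nthreshold (a - 1) (b # \<beta>)) =
          of_nat b * g (nthreshold a (Suc b # \<beta>)) + of_nat (a - b - 1) * g (Suc (nthreshold (a - b - 1) \<beta>))"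
        using ne False Cons.prems b less_imp_Suc_add[of b a]
        by (auto simp: nthreshold_Cons of_nat_diff algebra_simps)
      with * 1 False show ?thesis by simp
    qed
  qed
  finally show ?case .
qed simp

text \<open>Incrementing a part keeps the length, so \<open>mu\<close> varies only through the
  threshold index.\<close>

lemma mu_increment:
  assumes "1 \<le> a" "a \<le> Suc (sum_list \<beta>)" "\<forall>x\<in>set \<beta>. 1 \<le> x"
  shows "(\<Sum>i<length \<beta>. of_nat (\<beta> ! i) * mu a (\<beta>[i := Suc (\<beta> ! i)])) =
    of_nat (a - 1) * mu (a - 1) \<beta> + of_nat (Suc (sum_list \<beta>) - a) * mu a \<beta>"
  using sum_nthreshold_increment[OF assms, of "bernoulli_one (length \<beta>)"]
  by (simp add: mu_def uri_mult_def nthreshold_def)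

lemma mu_zero [simp]: "mu 0 \<alpha> = 0"
  by (simp add: mu_def uri_mult_def threshold_ind_nonpos bernoulli_one_def)

text \<open>Truncated subtraction is faithful because every threshold \<le> 0 gives multiplicity
  0.\<close>

lemma uri_mult_diff: "uri_mult (int b - int d) (map int \<alpha>) = mu (b - d) \<alpha>"
proof (cases "d \<le> b")
  case False
  then show ?thesis by (simp add: uri_mult_def threshold_ind_nonpos bernoulli_one_def)
qed (simp add: mu_def of_nat_diff)

section \<open>Commutation of the lowering operators with \<open>uri_tri\<close>\<close>

lemma uri_tri_add: "uri_tri (x + x') y = uri_tri x y + uri_tri x' y"
    "uri_tri x (y + y') = uri_tri x y + uri_tri x y'"
  and uri_tri_scale: "uri_tri (c \<cdot> x) y = c \<cdot> uri_tri x y" "uri_tri x (c \<cdot> y) = c \<cdot> uri_tri x y"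
  and uri_tri_zero [simp]: "uri_tri 0 y = 0" "uri_tri x 0 = 0"
  and uri_tri_br: "uri_tri x (br y z) = br (uri_tri x y) z + br y (uri_tri x z)"
  by (transfer; simp add: uri_magma_simps uri_magma_derivation lie_ideal_zero)+

lemma uri_tri_sum: "uri_tri x (sum f A) = (\<Sum>i\<in>A. uri_tri x (f i))"
  by (induction A rule: infinite_finite_induct) (simp_all add: uri_tri_add)

lemma uri_tri_letter_0 [simp]: "uri_tri x (letter 0) = 0"
proof (induction x rule: free_lie.abs_induct)
  case (1 X)
  have "uri_magma X (qof (Gen 0)) = 0"
    by (simp add: uri_magma_def bilin_ext_def uri_gen_def lin_ext_def)
  then show ?case by (simp add: letter_def uri_tri.abs_eq zero_free_lie_def)
qed

section \<open>Lowering one part of a composition\<close>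

lemma mem_compositions: "\<alpha> \<in> compositions (int m) \<longleftrightarrow> (\<forall>x\<in>set \<alpha>. 1 \<le> x) \<and> sum_list \<alpha> = m"
  by (auto simp: compositions_def)

lemma compositions_decrement:
  assumes "\<alpha> \<in> compositions (int (Suc m))" "i < length \<alpha>" "2 \<le> \<alpha> ! i"
  shows "\<alpha>[i := \<alpha> ! i - 1] \<in> compositions (int m)"
proof -
  have "\<alpha> ! i \<le> sum_list \<alpha>" using assms(2) by (rule elem_le_sum_list)
  then show ?thesis
    using assms unfolding mem_compositions
    by (auto simp: sum_list_update all_set_conv_all_nth nth_list_update)
qed

lemma compositions_increment:
  assumes "\<beta> \<in> compositions (int m)" "i < length \<beta>"
  shows "\<beta>[i := Suc (\<beta> ! i)] \<in> compositions (int (Suc m))"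
proof -
  have "\<beta> ! i \<le> sum_list \<beta>" using assms(2) by (rule elem_le_sum_list)
  then show ?thesis
    using assms unfolding mem_compositions
    by (auto simp: sum_list_update all_set_conv_all_nth nth_list_update)
qed

lemma sum_compositions_decrement:
  fixes f :: "nat list \<Rightarrow> nat \<Rightarrow> 'a::comm_monoid_add"
  assumes "\<And>\<beta> i. i < length \<beta> \<Longrightarrow> \<beta> ! i = 0 \<Longrightarrow> f \<beta> i = 0"
  shows "(\<Sum>\<alpha>\<in>compositions (int (Suc m)). \<Sum>i<length \<alpha>. f (\<alpha>[i := \<alpha> ! i - 1]) i) =
    (\<Sum>\<beta>\<in>compositions (int m). \<Sum>i<length \<beta>. f \<beta> i)"
proof -
  let ?A = "SIGMA \<alpha>:compositions (int (Suc m)). {..<length \<alpha>}"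
  let ?A' = "{(\<alpha>, i) \<in> ?A. 2 \<le> \<alpha> ! i}"
  let ?B = "SIGMA \<beta>:compositions (int m). {..<length \<beta>}"
  have "(\<Sum>\<alpha>\<in>compositions (int (Suc m)). \<Sum>i<length \<alpha>. f (\<alpha>[i := \<alpha> ! i - 1]) i) =
      (\<Sum>(\<alpha>, i)\<in>?A. f (\<alpha>[i := \<alpha> ! i - 1]) i)"
    by (rule sum.Sigma) (simp_all add: finite_compositions del: of_nat_Suc)
  \<comment> \<open>A part equal to 1 becomes 0 and its term vanishes by assumption; lowering a part
    \<ge> 2 is inverse to incrementing.\<close>
  also have "\<dots> = (\<Sum>(\<alpha>, i)\<in>?A'. f (\<alpha>[i := \<alpha> ! i - 1]) i)"
    by (rule sum.mono_neutral_right)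
      (auto simp: finite_compositions intro!: assms simp del: of_nat_Suc)
  also have "\<dots> = (\<Sum>(\<beta>, i)\<in>?B. f \<beta> i)"
  proof (rule sum.reindex_bij_witness[where j = "\<lambda>(\<alpha>, i). (\<alpha>[i := \<alpha> ! i - 1], i)"
        and i = "\<lambda>(\<beta>, i). (\<beta>[i := Suc (\<beta> ! i)], i)"], goal_cases)
    case (2 p)
    then show ?case using compositions_decrement by (auto simp del: of_nat_Suc)
  next
    case (4 p)
    have "1 \<le> \<beta> ! i" if "\<beta> \<in> compositions (int m)" "i < length \<beta>" for \<beta> i
      using that unfolding mem_compositions by auto
    moreover obtain \<beta> i where "p = (\<beta>, i)" "\<beta> \<in> compositions (int m)" "i < length \<beta>"
      using 4 by auto
    ultimately show ?case
      using compositions_increment[of \<beta> m i] by (simp del: of_nat_Suc)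
  next
    case (1 p)
    then show ?case by (cases p) simp
  next
    case (3 p)
    then show ?case by (cases p) simp
  next
    case (5 p)
    then show ?case by (cases p) simp
  qed
  also have "\<dots> = (\<Sum>\<beta>\<in>compositions (int m). \<Sum>i<length \<beta>. f \<beta> i)"
    by (rule sum.Sigma[symmetric]) (simp_all add: finite_compositions)
  finally show ?thesis .
qed

lemma hasse_1_ad_word:
  "hasse 1 (ad_word \<alpha> x) =
    ad_word \<alpha> (hasse 1 x) - (\<Sum>i<length \<alpha>. of_nat (\<alpha> ! i - 1) \<cdot> ad_word (\<alpha>[i := \<alpha> ! i - 1]) x)"
proof (induction \<alpha>)
  case (Cons b \<alpha>)
  have "hasse 1 (ad_word (b # \<alpha>) x) =
    br (letter b) (ad_word \<alpha> (hasse 1 x)) - of_nat (b - 1) \<cdot> br (letter (b - 1)) (ad_word \<alpha> x) -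
      (\<Sum>i<length \<alpha>. of_nat (\<alpha> ! i - 1) \<cdot> br (letter b) (ad_word (\<alpha>[i := \<alpha> ! i - 1]) x))"
    unfolding ad_word_simps hasse_1_bracket hasse_1_letter Cons
    by (simp add: br_scale br_uminus br_sum br_diff)
  also have "\<dots> = ad_word (b # \<alpha>) (hasse 1 x) - (\<Sum>i<length (b # \<alpha>).
      of_nat ((b # \<alpha>) ! i - 1) \<cdot> ad_word ((b # \<alpha>)[i := (b # \<alpha>) ! i - 1]) x)"
    by (simp only: list.size add_0_right add_Suc_right sum.lessThan_Suc_shift)
      (simp add: diff_diff_eq)
  finally show ?case .
qed simp

text \<open>By the Leibniz rule D acts on x or lowers one part of \<alpha>. Collecting the latter
  terms by the lowered composition \<beta> produces the weighted sum of
  \<open>mu_increment\<close>.\<close>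

lemma hasse_1_uri_word:
  assumes "1 \<le> a"
  shows "hasse 1 (uri_word a n x) = uri_word a n (hasse 1 x) -
    of_nat (a - 1) \<cdot> uri_word (a - 1) n x - of_nat n \<cdot> uri_word a (n - 1) x"
proof -
  obtain m where m: "a + n = Suc m" using assms by (cases "a + n") auto
  \<comment> \<open>The factor \<open>\<alpha> ! i - 1\<close> coming from the letter is the part
    \<open>\<beta> ! i\<close> of the lowered composition.\<close>
  let ?f = "\<lambda>\<beta> i. (mu a (\<beta>[i := Suc (\<beta> ! i)]) * of_nat (\<beta> ! i)) \<cdot> ad_word \<beta> x"
  have "(\<Sum>\<alpha>\<in>compositions (int (a + n)).
      mu a \<alpha> \<cdot> (\<Sum>i<length \<alpha>. of_nat (\<alpha> ! i - 1) \<cdot> ad_word (\<alpha>[i := \<alpha> ! i - 1]) x)) =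
      (\<Sum>\<alpha>\<in>compositions (int (a + n)). \<Sum>i<length \<alpha>. ?f (\<alpha>[i := \<alpha> ! i - 1]) i)"
  proof (intro sum.cong refl)
    fix \<alpha> assume "\<alpha> \<in> compositions (int (a + n))"
    then have pos: "1 \<le> \<alpha> ! i" if "i < length \<alpha>" for i
      using that unfolding mem_compositions by auto
    have "Suc (\<alpha> ! i - 1) = \<alpha> ! i" if "i < length \<alpha>" for i
      using pos[OF that] by simp
    then show "mu a \<alpha> \<cdot> (\<Sum>i<length \<alpha>. of_nat (\<alpha> ! i - 1) \<cdot> ad_word (\<alpha>[i := \<alpha> ! i - 1]) x) =
        (\<Sum>i<length \<alpha>. ?f (\<alpha>[i := \<alpha> ! i - 1]) i)"
      unfolding fl.scale_sum_right by (intro sum.cong refl) simp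
  qed
  also have "\<dots> = (\<Sum>\<beta>\<in>compositions (int m). \<Sum>i<length \<beta>. ?f \<beta> i)"
    unfolding m by (rule sum_compositions_decrement) simp
  also have "\<dots> = (\<Sum>\<beta>\<in>compositions (int m).
      (of_nat (a - 1) * mu (a - 1) \<beta> + of_nat n * mu a \<beta>) \<cdot> ad_word \<beta> x)"
  proof (intro sum.cong refl)
    fix \<beta> assume "\<beta> \<in> compositions (int m)"
    then have "(\<Sum>i<length \<beta>. mu a (\<beta>[i := Suc (\<beta> ! i)]) * of_nat (\<beta> ! i)) =
        of_nat (a - 1) * mu (a - 1) \<beta> + of_nat n * mu a \<beta>"
      using mu_increment[of a \<beta>] assms m unfolding mem_compositions by (simp add: mult.commute)
    then show "(\<Sum>i<length \<beta>. ?f \<beta> i) =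
        (of_nat (a - 1) * mu (a - 1) \<beta> + of_nat n * mu a \<beta>) \<cdot> ad_word \<beta> x"
      by (simp only: fl.scale_sum_left[symmetric])
  qed
  also have "\<dots> = of_nat (a - 1) \<cdot> (\<Sum>\<beta>\<in>compositions (int m). mu (a - 1) \<beta> \<cdot> ad_word \<beta> x) +
      of_nat n \<cdot> (\<Sum>\<beta>\<in>compositions (int m). mu a \<beta> \<cdot> ad_word \<beta> x)"
    by (simp add: fl.scale_left_distrib sum.distrib fl.scale_sum_right)
  also have "\<dots> = of_nat (a - 1) \<cdot> uri_word (a - 1) n x + of_nat n \<cdot> uri_word a (n - 1) x"
  proof -
    have 1: "m = a - 1 + n" using m assms by simp
    show ?thesis
    \<comment> \<open>For n = 0 the index \<open>n - 1\<close> is truncated to 0, but its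
      coefficient is 0 as well.\<close>
    proof (cases "n = 0")
      case False
      then have 2: "m = a + (n - 1)" using m by simp
      show ?thesis
        by (simp only: uri_word_def 1[symmetric] 2[symmetric])
    qed (simp add: uri_word_def 1)
  qed
  finally show ?thesis
    unfolding uri_word_def[of a n] hasse_sum hasse_scale hasse_1_ad_word
    by (simp only: fl.scale_right_diff_distrib sum_subtractf) (simp add: diff_diff_eq)
qed

text \<open>Since \<open>hasse 1 (hasse n x)\<close> is n + 1 times \<open>hasse (Suc n) x\<close>,
  the terms where D passes to x cancel, after a shift of n, against those with
  \<open>uri_word a (n - 1)\<close>. What remains is the action on the lowered letter.\<close>

lemma hasse_1_uri_tri: "hasse 1 (uri_tri x y) = uri_tri x (hasse 1 y)"
proof (induction y rule: free_lie_induct)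
  case (letter a)
  show ?case
  proof (cases "a = 0")
    case False
    obtain N where N: "\<forall>n\<ge>N. hasse n x = 0" using hasse_nilpotent by blast
    have "(\<Sum>n<N. uri_word a n (hasse 1 (hasse n x))) =
        (\<Sum>n<N. of_nat (Suc n) \<cdot> uri_word a n (hasse (Suc n) x))"
      by (simp only: hasse_Suc[symmetric] uri_word_scale)
    also have "\<dots> = (\<Sum>n<Suc N. of_nat n \<cdot> uri_word a (n - 1) (hasse n x))"
      by (simp only: sum.lessThan_Suc_shift) simp
    also have "\<dots> = (\<Sum>n<N. of_nat n \<cdot> uri_word a (n - 1) (hasse n x))"
      by (simp add: N)
    finally have "hasse 1 (uri_tri x (letter a)) =
        - (of_nat (a - 1) \<cdot> (\<Sum>n<N. uri_word (a - 1) n (hasse n x)))"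
      using False
      by (simp only: uri_tri_letter[OF _ N] hasse_sum hasse_1_uri_word sum_subtractf
          fl.scale_sum_right[symmetric] Suc_leI One_nat_def[symmetric] neq0_conv) simp
    also have "\<dots> = uri_tri x (hasse 1 (letter a))"
    \<comment> \<open>The formula for the action on a letter requires index \<ge> 1; for a = 1 both
      sides are 0.\<close>
    proof (cases "a = 1")
      case ne: False
      with False have "1 \<le> a - 1" by simp
      then show ?thesis
        by (simp only: hasse_1_letter uri_tri_scale uri_tri_letter[OF _ N]) (simp only: fl.scale_minus_left)
    qed (simp add: hasse_letter ari_binom_def)
    finally show ?thesis .
  qed (simp add: hasse_letter)
qed (simp_all add: hasse_add hasse_scale uri_tri_add uri_tri_scale hasse_1_bracket uri_tri_br br_add
    add_ac del: One_nat_def)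

text \<open>Up to division by nonzero integers, \<open>hasse n\<close> is an iterate of
  \<open>hasse 1\<close>.\<close>

lemma hasse_uri_tri: "hasse n (uri_tri x y) = uri_tri x (hasse n y)"
proof (induction n)
  case (Suc n)
  have "of_nat (Suc n) \<cdot> hasse (Suc n) (uri_tri x y) = of_nat (Suc n) \<cdot> uri_tri x (hasse (Suc n) y)"
    by (simp only: hasse_Suc Suc hasse_1_uri_tri uri_tri_scale(2)[symmetric])
  then show ?case
    by (simp only: fl.scale_cancel_left) (simp del: of_nat_Suc)
qed simp

lemma uri_tri_ad_word:
  "uri_tri x (ad_word \<alpha> y) = ad_word \<alpha> (uri_tri x y) +
    (\<Sum>p<length \<alpha>. ad_word (take p \<alpha>) (br (uri_tri x (letter (\<alpha> ! p))) (ad_word (drop (Suc p) \<alpha>) y)))"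
proof (induction \<alpha>)
  case (Cons b \<alpha>)
  show ?case
    by (simp only: list.size add_0_right add_Suc_right sum.lessThan_Suc_shift)
      (simp add: uri_tri_br Cons br_add br_sum add_ac)
qed simp

section \<open>Unshuffles and the adjoint action\<close>

fun unshuffles :: "'a list \<Rightarrow> ('a list \<times> 'a list) list" where
  "unshuffles [] = [([], [])]"
| "unshuffles (c # w) = map (apfst ((#) c)) (unshuffles w) @ map (apsnd ((#) c)) (unshuffles w)"

text \<open>The coefficient of \<open>w\<close> in the shuffle product of \<open>s\<close> and
  \<open>t\<close>; counting in a list keeps the multiplicities caused by repeated letters.\<close>

definition shuffle_count :: "'a list \<Rightarrow> 'a list \<Rightarrow> 'a list \<Rightarrow> nat" where
  "shuffle_count w s t = count_list (unshuffles w) (s, t)"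

lemma count_list_map_Cons:
  "count_list (map (apfst ((#) c)) L) (s, t) = (if s \<noteq> [] \<and> hd s = c then count_list L (tl s, t) else 0)"
  "count_list (map (apsnd ((#) c)) L) (s, t) = (if t \<noteq> [] \<and> hd t = c then count_list L (s, tl t) else 0)"
  by (cases s; cases t; induction L; auto simp: apfst_def apsnd_def)+

lemma shuffle_count_Cons:
  "shuffle_count (c # w) s t =
    (if s \<noteq> [] \<and> hd s = c then shuffle_count w (tl s) t else 0) +
    (if t \<noteq> [] \<and> hd t = c then shuffle_count w s (tl t) else 0)"
  by (simp add: shuffle_count_def count_list_map_Cons)

lemma shuffle_count_Nil: "shuffle_count [] s t = (if s = [] \<and> t = [] then 1 else 0)"
  by (auto simp: shuffle_count_def)

lemma shuffle_count_Nil_left: "shuffle_count w [] t = (if w = t then 1 else 0)"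
proof (induction w arbitrary: t)
  case (Cons c w)
  then show ?case by (cases t) (auto simp: shuffle_count_Cons)
qed (auto simp: shuffle_count_Nil)

lemma shuffle_count_commute: "shuffle_count w s t = shuffle_count w t s"
  by (induction w arbitrary: s t) (auto simp: shuffle_count_Nil shuffle_count_Cons)

lemma set_unshuffles:
  assumes "(s, t) \<in> set (unshuffles w)"
  shows "set s \<union> set t = set w" "sum_list s + sum_list t = (sum_list w :: nat)"
proof -
  have "set s \<union> set t = set w \<and> sum_list s + sum_list t = sum_list w"
    using assms by (induction w arbitrary: s t) fastforce+
  then show "set s \<union> set t = set w" "sum_list s + sum_list t = sum_list w" by auto
qed

text \<open>Each letter acts as a derivation of the bracket, so it goes to one of the two factors,
  and the order of letters is kept.\<close>

lemma ad_word_br: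
  "ad_word w (br x y) = (\<Sum>(s, t)\<leftarrow>unshuffles w. br (ad_word s x) (ad_word t y))"
proof (induction w)
  case (Cons c w)
  have "br z (\<Sum>(s, t)\<leftarrow>L. br (ad_word s x) (ad_word t y)) =
      (\<Sum>(s, t)\<leftarrow>L. br (br z (ad_word s x)) (ad_word t y)) +
      (\<Sum>(s, t)\<leftarrow>L. br (ad_word s x) (br z (ad_word t y)))" for z L
  proof (induction L)
    case (Cons p L)
    then show ?case
      using br_leibniz[of z "ad_word (fst p) x" "ad_word (snd p) y"]
      by (simp add: br_add case_prod_unfold)
  qed simp
  then show ?case
    by (simp add: Cons comp_def case_prod_unfold)
qed simp

lemma sum_list_scale_count:
  assumes "finite P" "set L \<subseteq> P"
  shows "(\<Sum>p\<leftarrow>L. f p) = (\<Sum>p\<in>P. of_nat (count_list L p) \<cdot> f p)"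
  using assms(2)
proof (induction L)
  case (Cons q L)
  have "(\<Sum>p\<in>P. of_nat (count_list (q # L) p) \<cdot> f p) =
      (\<Sum>p\<in>P. (if q = p then f p else 0) + of_nat (count_list L p) \<cdot> f p)"
    by (intro sum.cong) (auto simp: fl.scale_left_distrib)
  then show ?case using Cons assms(1) by (simp add: sum.distrib)
qed simp

definition comp_pairs :: "nat \<Rightarrow> (nat list \<times> nat list) set" where
  "comp_pairs m = {(s, t). (\<forall>x\<in>set s \<union> set t. 1 \<le> x) \<and> sum_list s + sum_list t = m}"

lemma finite_comp_pairs: "finite (comp_pairs m)"
proof (rule finite_subset)
  let ?C = "\<Union>k\<le>m. compositions (int k)"
  show "comp_pairs m \<subseteq> ?C \<times> ?C"
    unfolding comp_pairs_def by (force simp: mem_compositions)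
qed (simp add: finite_compositions)

lemma ad_word_br_comp_pairs:
  assumes "\<forall>x\<in>set w. 1 \<le> x"
  shows "ad_word w (br x y) = (\<Sum>(s, t)\<in>comp_pairs (sum_list w).
    of_nat (shuffle_count w s t) \<cdot> br (ad_word s x) (ad_word t y))"
proof -
  have "set (unshuffles w) \<subseteq> comp_pairs (sum_list w)"
    unfolding comp_pairs_def using assms by (auto dest: set_unshuffles)
  then show ?thesis
    unfolding ad_word_br
    by (subst sum_list_scale_count[OF finite_comp_pairs])
      (auto simp: shuffle_count_def intro!: sum.cong)
qed

section \<open>Linear functionals on shuffle products\<close>

definition frag_eval :: "('a \<Rightarrow> rat) \<Rightarrow> ('a \<Rightarrow>\<^sub>0 int) \<Rightarrow> rat" where
  "frag_eval h x = (\<Sum>i\<in>Poly_Mapping.keys x. of_int (Poly_Mapping.lookup x i) * h i)"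

lemma frag_eval_superset:
  assumes "finite A" "Poly_Mapping.keys x \<subseteq> A"
  shows "frag_eval h x = (\<Sum>i\<in>A. of_int (Poly_Mapping.lookup x i) * h i)"
  unfolding frag_eval_def using assms by (intro sum.mono_neutral_left) (auto simp: in_keys_iff)

lemma frag_eval_diff: "frag_eval h (x - y) = frag_eval h x - frag_eval h y"
proof -
  let ?A = "Poly_Mapping.keys x \<union> Poly_Mapping.keys y"
  have "Poly_Mapping.keys (x - y) \<subseteq> ?A" by (rule keys_diff)
  then show ?thesis
    by (simp add: frag_eval_superset[of ?A] lookup_minus algebra_simps sum_subtractf)
qed

lemma frag_eval_add: "frag_eval h (x + y) = frag_eval h x + frag_eval h y"
  using frag_eval_diff[of h "x + y" y] by simp

lemma frag_eval_zero [simp]: "frag_eval h 0 = 0"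
  and frag_eval_frag_of [simp]: "frag_eval h (frag_of i) = h i"
  by (simp_all add: frag_eval_def)

lemma frag_eval_extend:
  "frag_eval h (frag_extend g x) = frag_eval (\<lambda>i. frag_eval h (g i)) x"
  by (rule frag_induction[of x UNIV]) (simp_all add: frag_extend_diff frag_eval_diff)

lemma sum_compositions_Cons:
  assumes "0 < n"
  shows "sum f (compositions (int n)) = (\<Sum>c\<in>{1..n}. \<Sum>w\<in>compositions (int (n - c)). f (c # w))"
proof -
  have "compositions (int n) = (\<Union>c\<in>{1..n}. (#) c ` compositions (int (n - c)))"
  proof (intro equalityI subsetI)
    fix w assume w: "w \<in> compositions (int n)"
    with assms obtain c v where "w = c # v"
      by (cases w) (auto simp: mem_compositions)
    with w show "w \<in> (\<Union>c\<in>{1..n}. (#) c ` compositions (int (n - c)))"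
      by (auto simp: mem_compositions simp del: of_nat_diff intro!: bexI[of _ c])
  qed (auto simp: mem_compositions simp del: of_nat_diff)
  then show ?thesis
    by (simp only:) (subst sum.UNION_disjoint, auto simp: finite_compositions sum.reindex)
qed

text \<open>Both sides obey the same recursion: the first letter of a word in the shuffle comes from
  s or from t. The functional \<open>h\<close> varies in the induction because prepending a letter
  is absorbed into it.\<close>

lemma frag_eval_shuffle_seq:
  assumes "\<forall>x\<in>set s \<union> set t. 1 \<le> x"
  shows "frag_eval h (shuffle_seq (map int s) (map int t)) =
    (\<Sum>w\<in>compositions (int (sum_list s + sum_list t)). of_nat (shuffle_count w s t) * h (map int w))"
  using assms
proof (induction s t arbitrary: h rule: shuffles.induct)
  case (1 t)
  then have "t \<in> compositions (int (sum_list t))" by (simp add: mem_compositions)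
  then show ?case
    by (simp add: shuffle_count_Nil_left if_distrib[of of_nat] if_distrib[of "\<lambda>x. x * _"]
      finite_compositions cong: if_cong)
next
  case (2 s)
  then have "s \<in> compositions (int (sum_list s))" by (simp add: mem_compositions)
  moreover have "shuffle_seq (map int s) [] = frag_of (map int s)"
    by (cases s) auto
  ultimately show ?case
    by (simp add: shuffle_count_Nil_left shuffle_count_commute[of _ s]
      if_distrib[of of_nat] if_distrib[of "\<lambda>x. x * _"]
      finite_compositions cong: if_cong)
next
  case (3 x s y t)
  define n where "n = sum_list (x # s) + sum_list (y # t)"
  have n: "0 < n" "x \<in> {1..n}" "y \<in> {1..n}" "n - x = sum_list s + sum_list (y # t)"
      "n - y = sum_list (x # s) + sum_list t"
    using 3(3) by (auto simp: n_def)
  \<comment> \<open>Once the first part c is split off, only c = x and c = y contribute; for x = y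
    both terms are counted.\<close>
  have "(\<Sum>w\<in>compositions (int n). of_nat (shuffle_count w (x # s) (y # t)) * h (map int w)) =
      (\<Sum>c\<in>{1..n}. \<Sum>w\<in>compositions (int (n - c)).
        (if c = x then of_nat (shuffle_count w s (y # t)) * h (int x # map int w) else 0) +
        (if c = y then of_nat (shuffle_count w (x # s) t) * h (int y # map int w) else 0))"
    unfolding sum_compositions_Cons[OF n(1)]
    by (intro sum.cong refl) (auto simp: shuffle_count_Cons algebra_simps)
  also have "\<dots> = (\<Sum>c\<in>{1..n}.
      (if c = x then \<Sum>w\<in>compositions (int (n - c)). of_nat (shuffle_count w s (y # t)) * h (int x # map int w) else 0) +
      (if c = y then \<Sum>w\<in>compositions (int (n - c)). of_nat (shuffle_count w (x # s) t) * h (int y # map int w) else 0))"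
    unfolding sum.distrib by (intro arg_cong2[of _ _ _ _ "(+)"] sum.cong refl) auto
  also have "\<dots> =
      (\<Sum>w\<in>compositions (int (n - x)). of_nat (shuffle_count w s (y # t)) * h (int x # map int w)) +
      (\<Sum>w\<in>compositions (int (n - y)). of_nat (shuffle_count w (x # s) t) * h (int y # map int w))"
    using n by (simp only: sum.distrib sum.delta finite_atLeastAtMost if_True)
  also have "\<dots> = frag_eval (\<lambda>w. h (int x # w)) (shuffle_seq (map int s) (map int (y # t))) +
      frag_eval (\<lambda>w. h (int y # w)) (shuffle_seq (map int (x # s)) (map int t))"
  proof -
    have "\<forall>z\<in>set s \<union> set (y # t). 1 \<le> z" "\<forall>z\<in>set (x # s) \<union> set t. 1 \<le> z"
      using 3(3) by simp_all
    then show ?thesis by (simp only: 3(1,2) n(4,5))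
  qed
  also have "\<dots> = frag_eval h (shuffle_seq (map int (x # s)) (map int (y # t)))"
    by (simp add: frag_eval_add frag_eval_extend)
  finally show ?case by (simp only: n_def)
qed

section \<open>The first threshold shuffle identity in the Lie algebra\<close>

text \<open>The multiplicity \<mu> at threshold a of the shuffle of s and t followed by u.\<close>

definition mu_shuffle :: "nat \<Rightarrow> nat list \<Rightarrow> nat list \<Rightarrow> nat list \<Rightarrow> rat" where
  "mu_shuffle a s t u =
    (\<Sum>w\<in>compositions (int (sum_list s + sum_list t)). of_nat (shuffle_count w s t) * mu a (w @ u))"

lemma mu_shuffle_commute: "mu_shuffle a s t u = mu_shuffle a t s u"
  unfolding mu_shuffle_def by (subst shuffle_count_commute) (simp only: add.commute)

lemma uri_mult_ext_frag_eval: "uri_mult_ext a = frag_eval (uri_mult a)"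
  by (simp add: fun_eq_iff uri_mult_ext_def frag_eval_def)

lemma uri_mult_ext_shuffle:
  assumes "\<forall>x\<in>set s \<union> set t. 1 \<le> x"
  shows "uri_mult_ext (int a) (frag_of (map int s) \<bowtie> frag_of (map int t)) = mu_shuffle a s t []"
  by (simp add: frag_eval_shuffle_seq[OF assms] uri_mult_ext_frag_eval shuffle_def mu_shuffle_def mu_def)

lemma uri_mult_ext_shuffle_conc:
  assumes "\<forall>x\<in>set s \<union> set t. 1 \<le> x"
  shows "uri_mult_ext (int a) (frag_of (map int s) \<bowtie> frag_of (map int t) \<odot>
    frag_of [int b] \<odot> frag_of (map int u)) = mu_shuffle a s t (b # u)"
  by (simp add: frag_eval_shuffle_seq[OF assms] uri_mult_ext_frag_eval shuffle_def mu_shuffle_def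
      mu_def conc_def frag_eval_extend)

lemma decomps_map: "decomps (map f k) = (\<lambda>(k1, k2). (map f k1, map f k2)) ` decomps k"
  unfolding decomps_def append_eq_map_conv by auto

lemma sum_decomps_map:
  assumes "inj f"
  shows "sum g (decomps (map f k)) = (\<Sum>(k1, k2)\<in>decomps k. g (map f k1, map f k2))"
proof -
  have "inj_on (\<lambda>(k1, k2). (map f k1, map f k2)) (decomps k)"
    using assms by (auto simp: inj_on_def inj_map_eq_map)
  then show ?thesis
    by (simp add: decomps_map sum.reindex case_prod_unfold)
qed

text \<open>The identity is taken at d1 = i and d2 = j, which makes t the natural number a.\<close>

lemma threshold_shuffle_identity_1_nat:
  assumes id1: threshold_shuffle_identity_1
    and pos: "\<forall>x\<in>set s \<union> set t. 1 \<le> x" and sum: "sum_list s + sum_list t = a + i + j"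
  shows "mu_shuffle a s t [] = (\<Sum>(s1, s2)\<in>decomps s. \<Sum>(t1, t2)\<in>decomps t.
    mu (sum_list s2 - i) s2 * mu_shuffle a s1 t1 ((sum_list s2 - i) # t2) +
    mu (sum_list t2 - j) t2 * mu_shuffle a s1 t1 ((sum_list t2 - j) # s2))"
proof -
  let ?s = "map int s" and ?t = "map int t"
  have *: "uri_mult (int (sum_list v) - int d) (map int v) * uri_mult_ext (int a)
      (frag_of (map int s1) \<bowtie> frag_of (map int t1) \<odot> frag_of [int (sum_list v) - int d] \<odot> frag_of (map int u)) =
      mu (sum_list v - d) v * mu_shuffle a s1 t1 ((sum_list v - d) # u)"
    if "\<forall>x\<in>set s1 \<union> set t1. 1 \<le> x" for v d s1 t1 u
  \<comment> \<open>If d exceeds the weight of v, the inserted entry would be negative, but the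
    first factor is 0 on both sides.\<close>
  proof (cases "d \<le> sum_list v")
    case True
    then have "int (sum_list v) - int d = int (sum_list v - d)" by simp
    then show ?thesis
      by (simp only: uri_mult_ext_shuffle_conc[OF that]) (simp only: mu_def)
  qed (simp add: uri_mult_diff)
  have "pos_entries ?s" "pos_entries ?t" "int a = sum_list ?s + sum_list ?t - int i - int j"
    using pos sum by (auto simp: pos_entries_def sum_list_int)
  then have "uri_mult_ext (int a) (frag_of ?s \<bowtie> frag_of ?t) =
    (\<Sum>(s1, s2)\<in>decomps ?s. \<Sum>(t1, t2)\<in>decomps ?t.
        uri_mult (sum_list s2 - int i) s2 * uri_mult_ext (int a)
          (frag_of s1 \<bowtie> frag_of t1 \<odot> frag_of [sum_list s2 - int i] \<odot> frag_of t2) +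
        uri_mult (sum_list t2 - int j) t2 * uri_mult_ext (int a)
          (frag_of s1 \<bowtie> frag_of t1 \<odot> frag_of [sum_list t2 - int j] \<odot> frag_of s2))"
    using id1 unfolding threshold_shuffle_identity_1_def by blast
  then have "mu_shuffle a s t [] = (\<Sum>(s1, s2)\<in>decomps s. \<Sum>(t1, t2)\<in>decomps t.
        uri_mult (int (sum_list s2) - int i) (map int s2) * uri_mult_ext (int a)
          (frag_of (map int s1) \<bowtie> frag_of (map int t1) \<odot> frag_of [int (sum_list s2) - int i] \<odot> frag_of (map int t2)) +
        uri_mult (int (sum_list t2) - int j) (map int t2) * uri_mult_ext (int a)
          (frag_of (map int s1) \<bowtie> frag_of (map int t1) \<odot> frag_of [int (sum_list t2) - int j] \<odot> frag_of (map int s2)))"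
    by (simp only: uri_mult_ext_shuffle[OF pos] sum_decomps_map[OF inj_of_nat] prod.case sum_list_int)
  also have "\<dots> = (\<Sum>(s1, s2)\<in>decomps s. \<Sum>(t1, t2)\<in>decomps t.
    mu (sum_list s2 - i) s2 * mu_shuffle a s1 t1 ((sum_list s2 - i) # t2) +
    mu (sum_list t2 - j) t2 * mu_shuffle a s1 t1 ((sum_list t2 - j) # s2))"
  proof (intro sum.cong refl, clarsimp, intro sum.cong refl, clarsimp)
    fix s1 s2 t1 t2 assume "(s1, s2) \<in> decomps s" "(t1, t2) \<in> decomps t"
    then have "\<forall>x\<in>set s1 \<union> set t1. 1 \<le> x" using pos by (auto simp: decomps_def)
    then show "uri_mult (int (sum_list s2) - int i) (map int s2) * uri_mult_ext (int a)
          (frag_of (map int s1) \<bowtie> frag_of (map int t1) \<odot> frag_of [int (sum_list s2) - int i] \<odot> frag_of (map int t2)) +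
        uri_mult (int (sum_list t2) - int j) (map int t2) * uri_mult_ext (int a)
          (frag_of (map int s1) \<bowtie> frag_of (map int t1) \<odot> frag_of [int (sum_list t2) - int j] \<odot> frag_of (map int s2)) =
      mu (sum_list s2 - i) s2 * mu_shuffle a s1 t1 ((sum_list s2 - i) # t2) +
      mu (sum_list t2 - j) t2 * mu_shuffle a s1 t1 ((sum_list t2 - j) # s2)"
      by (simp only: *)
  qed
  finally show ?thesis .
qed

text \<open>Exchanging the sums over words and unshuffles collects, for each pair (s, t), the values
  \<open>mu a w\<close> weighted by the coefficient of w in the shuffle of s and t.\<close>

lemma uri_word_br:
  "uri_word a n (br x y) =
    (\<Sum>(s, t)\<in>comp_pairs (a + n). mu_shuffle a s t [] \<cdot> br (ad_word s x) (ad_word t y))"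
proof -
  have "uri_word a n (br x y) = (\<Sum>w\<in>compositions (int (a + n)). mu a w \<cdot>
      (\<Sum>(s, t)\<in>comp_pairs (a + n). of_nat (shuffle_count w s t) \<cdot> br (ad_word s x) (ad_word t y)))"
    unfolding uri_word_def
  proof (intro sum.cong refl)
    fix w assume "w \<in> compositions (int (a + n))"
    then have "\<forall>x\<in>set w. 1 \<le> x" "sum_list w = a + n" unfolding mem_compositions by auto
    then show "mu a w \<cdot> ad_word w (br x y) = mu a w \<cdot>
      (\<Sum>(s, t)\<in>comp_pairs (a + n). of_nat (shuffle_count w s t) \<cdot> br (ad_word s x) (ad_word t y))"
      by (simp add: ad_word_br_comp_pairs)
  qed
  also have "\<dots> = (\<Sum>p\<in>comp_pairs (a + n). \<Sum>w\<in>compositions (int (a + n)).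
      (of_nat (shuffle_count w (fst p) (snd p)) * mu a w) \<cdot> br (ad_word (fst p) x) (ad_word (snd p) y))"
    unfolding fl.scale_sum_right case_prod_unfold fl.scale_scale
    by (subst sum.swap) (simp only: mult.commute)
  also have "\<dots> = (\<Sum>(s, t)\<in>comp_pairs (a + n). mu_shuffle a s t [] \<cdot> br (ad_word s x) (ad_word t y))"
    unfolding fl.scale_sum_left[symmetric]
  proof (intro sum.cong refl)
    fix p assume "p \<in> comp_pairs (a + n)"
    then have "sum_list (fst p) + sum_list (snd p) = a + n"
      by (auto simp: comp_pairs_def)
    then show "(\<Sum>w\<in>compositions (int (a + n)).
        of_nat (shuffle_count w (fst p) (snd p)) * mu a w) \<cdot> br (ad_word (fst p) x) (ad_word (snd p) y) =
        (case p of (s, t) \<Rightarrow> mu_shuffle a s t [] \<cdot> br (ad_word s x) (ad_word t y))"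
      by (simp only: mu_shuffle_def append_Nil2 case_prod_unfold)
  qed
  finally show ?thesis .
qed

text \<open>The part of the action of an element X on \<open>uri_word a j y\<close> in which the
  component x = \<open>hasse i X\<close> hits a letter of the word.\<close>

definition insert_words :: "nat \<Rightarrow> nat \<Rightarrow> nat \<Rightarrow> nat free_lie \<Rightarrow> nat free_lie \<Rightarrow> nat free_lie" where
  "insert_words a i j x y = (\<Sum>\<alpha>\<in>compositions (int (a + j)). mu a \<alpha> \<cdot> (\<Sum>p<length \<alpha>.
    ad_word (take p \<alpha>) (br (uri_word (\<alpha> ! p) i x) (ad_word (drop (Suc p) \<alpha>) y))))"

lemma finite_splittings: "finite {(w, b, u). w @ b # u \<in> compositions (int m)}"
proof (rule finite_subset)
  show "{(w, b, u). w @ b # u \<in> compositions (int m)} \<subseteq>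
      (\<lambda>(\<alpha>, p). (take p \<alpha>, \<alpha> ! p, drop (Suc p) \<alpha>)) `
      (SIGMA \<alpha>:compositions (int m). {..<length \<alpha>})"
  proof clarify
    fix w b u assume "w @ b # u \<in> compositions (int m)"
    then show "(w, b, u) \<in> (\<lambda>(\<alpha>, p). (take p \<alpha>, \<alpha> ! p, drop (Suc p) \<alpha>)) `
        (SIGMA \<alpha>:compositions (int m). {..<length \<alpha>})"
      by (intro image_eqI[of _ _ "(w @ b # u, length w)"]) auto
  qed
qed (simp add: finite_compositions)

text \<open>A composition with a marked position is the same as a factorization
  \<open>w @ b # u\<close>, the position being \<open>length w\<close>.\<close>

lemma sum_splittings:
  "(\<Sum>\<alpha>\<in>compositions (int m). \<Sum>p<length \<alpha>. f (take p \<alpha>) (\<alpha> ! p) (drop (Suc p) \<alpha>)) =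
    (\<Sum>(w, b, u)\<in>{(w, b, u). w @ b # u \<in> compositions (int m)}. f w b u)"
proof -
  have "(\<Sum>\<alpha>\<in>compositions (int m). \<Sum>p<length \<alpha>. f (take p \<alpha>) (\<alpha> ! p) (drop (Suc p) \<alpha>)) =
      (\<Sum>(\<alpha>, p)\<in>(SIGMA \<alpha>:compositions (int m). {..<length \<alpha>}).
        f (take p \<alpha>) (\<alpha> ! p) (drop (Suc p) \<alpha>))"
    by (rule sum.Sigma) (simp_all add: finite_compositions)
  also have "\<dots> = (\<Sum>(w, b, u)\<in>{(w, b, u). w @ b # u \<in> compositions (int m)}. f w b u)"
  proof (rule sum.reindex_bij_witness[where j = "\<lambda>(\<alpha>, p). (take p \<alpha>, \<alpha> ! p, drop (Suc p) \<alpha>)"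
        and i = "\<lambda>(w, b, u). (w @ b # u, length w)"], goal_cases)
    case (1 q)
    then show ?case using id_take_nth_drop[of "snd q" "fst q"] by auto
  next
    case (2 q)
    then show ?case using id_take_nth_drop[of "snd q" "fst q"] by auto
  qed auto
  finally show ?thesis .
qed

text \<open>If \<open>sum_list s2 \<le> i\<close>, the truncated difference is \<open>0\<close> and so is the factor \<open>mu 0 s2\<close>.\<close>

definition half_coeff :: "nat \<Rightarrow> nat \<Rightarrow> nat list \<Rightarrow> nat list \<Rightarrow> rat" where
  "half_coeff a i s t = (\<Sum>(s1, s2)\<in>decomps s. \<Sum>(t1, t2)\<in>decomps t.
    mu (sum_list s2 - i) s2 * mu_shuffle a s1 t1 ((sum_list s2 - i) # t2))"

lemma sum_Sigma_fst_snd: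
  assumes "finite A" "\<And>q. q \<in> A \<Longrightarrow> finite (B q)"
  shows "(\<Sum>q\<in>A. \<Sum>d\<in>B q. h q d) = (\<Sum>p\<in>Sigma A B. h (fst p) (snd p))"
  using assms by (subst sum.Sigma) (auto simp: case_prod_unfold)

text \<open>In \<open>w @ b # u\<close> the marked letter b is replaced by a word s2 of weight b + i
  acting on x, and w unshuffles into s1 acting on x and t1 acting on y. Thus s = s1 @ s2 acts on x
  and t = t1 @ u on y; conversely b is the weight of s2 minus i.\<close>

lemma insert_words_eq_half_coeff:
  "insert_words a i j x y =
    (\<Sum>(s, t)\<in>comp_pairs (a + j + i). half_coeff a i s t \<cdot> br (ad_word s x) (ad_word t y))"
proof -
  let ?R = "{(w, b, u). w @ b # u \<in> compositions (int (a + j))}"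
  let ?M = "comp_pairs (a + j + i)"
  define G where "G w s1 s2 t1 t2 b =
    (mu b s2 * (of_nat (shuffle_count w s1 t1) * mu a (w @ b # t2))) \<cdot>
      br (ad_word (s1 @ s2) x) (ad_word (t1 @ t2) y)" for w s1 s2 t1 t2 b
  \<comment> \<open>\<open>?BL\<close> lists the choices of s2 and (s1, t1) for given (w, b, u);
    \<open>?BR\<close> lists the cuts of s and t, and \<open>?CR\<close> then the words w.\<close>
  let ?BL = "\<lambda>q. compositions (int (fst (snd q) + i)) \<times> comp_pairs (sum_list (fst q))"
  let ?gL = "\<lambda>q z. G (fst q) (fst (snd z)) (fst z) (snd (snd z)) (snd (snd q)) (fst (snd q))"
  let ?BR = "\<lambda>q. decomps (fst q) \<times> decomps (snd q)"
  let ?CR = "\<lambda>p. compositions (int (sum_list (fst (fst (snd p))) + sum_list (fst (snd (snd p)))))"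
  let ?gR = "\<lambda>d w. G w (fst (fst d)) (snd (fst d)) (fst (snd d)) (snd (snd d)) (sum_list (snd (fst d)) - i)"
  have "insert_words a i j x y = (\<Sum>(w, b, u)\<in>?R. mu a (w @ b # u) \<cdot>
      ad_word w (br (uri_word b i x) (ad_word u y)))"
    unfolding sum_splittings[symmetric] insert_words_def fl.scale_sum_right
    by (intro sum.cong refl) (simp add: id_take_nth_drop[symmetric])
  also have "\<dots> = (\<Sum>q\<in>?R. \<Sum>z\<in>?BL q. ?gL q z)"
  proof (intro sum.cong refl, clarify)
    fix w b u assume "w @ b # u \<in> compositions (int (a + j))"
    then have w: "\<forall>x\<in>set w. 1 \<le> x" unfolding mem_compositions by auto
    have "mu a (w @ b # u) \<cdot> ad_word w (br (uri_word b i x) (ad_word u y)) =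
        (\<Sum>s2\<in>compositions (int (b + i)). \<Sum>p\<in>comp_pairs (sum_list w).
          G w (fst p) s2 (snd p) u b)"
      unfolding uri_word_def br_sum ad_word_sum br_scale ad_word_scale fl.scale_sum_right
        ad_word_br_comp_pairs[OF w] case_prod_unfold fl.scale_scale
      by (intro sum.cong refl) (simp add: G_def mult_ac)
    also have "\<dots> = (\<Sum>z\<in>compositions (int (b + i)) \<times> comp_pairs (sum_list w).
          G w (fst (snd z)) (fst z) (snd (snd z)) u b)"
      by (simp add: sum.cartesian_product case_prod_unfold)
    finally show "mu a (w @ b # u) \<cdot> ad_word w (br (uri_word b i x) (ad_word u y)) =
        (\<Sum>z\<in>?BL (w, b, u). ?gL (w, b, u) z)"
      by (simp only: fst_conv snd_conv)
  qed
  also have "\<dots> = (\<Sum>p\<in>Sigma ?R ?BL. ?gL (fst p) (snd p))"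
    by (rule sum_Sigma_fst_snd) (simp_all add: finite_splittings finite_compositions finite_comp_pairs del: of_nat_add)
  also have "\<dots> = (\<Sum>p\<in>Sigma (Sigma ?M ?BR) ?CR. ?gR (snd (fst p)) (snd p))"
  \<comment> \<open>Data where s2 has weight at most i have no preimage, since the letter b must be
    at least 1; their summands carry the factor \<open>mu 0 s2 = 0\<close>.\<close>
  proof (rule sum.reindex_bij_witness_not_neutral[where S' = "{}"
        and T' = "{p \<in> Sigma (Sigma ?M ?BR) ?CR. sum_list (snd (fst (snd (fst p)))) \<le> i}"
        and j = "\<lambda>((w, b, u), s2, (s1, t1)). (((s1 @ s2, t1 @ u), ((s1, s2), (t1, u))), w)"
        and i = "\<lambda>((q, ((s1, s2), (t1, t2))), w). ((w, sum_list s2 - i, t2), s2, (s1, t1))"], goal_cases)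
    case 2
    show ?case
      by (intro finite_subset[OF Collect_restrict] finite_SigmaI)
        (simp_all add: finite_comp_pairs finite_decomps finite_compositions)
  next
    case (3 p)
    then show ?case by (auto simp: mem_compositions simp del: of_nat_add)
  next
    case (4 p)
    then show ?case by (auto simp: mem_compositions comp_pairs_def decomps_def simp del: of_nat_add)
  next
    case (5 p)
    then show ?case by (auto simp: decomps_def)
  next
    case (6 p)
    then show ?case by (auto simp: mem_compositions comp_pairs_def decomps_def simp del: of_nat_add of_nat_diff)
  next
    case (8 p)
    then show ?case by (auto simp: G_def)
  next
    case (9 p)
    then show ?case by (auto simp: mem_compositions simp del: of_nat_add)
  qed auto
  also have "\<dots> = (\<Sum>p\<in>Sigma ?M ?BR. \<Sum>w\<in>?CR p. ?gR (snd p) w)"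
    by (rule sum_Sigma_fst_snd[symmetric])
      (auto simp: finite_comp_pairs finite_decomps finite_compositions simp del: of_nat_add)
  also have "\<dots> = (\<Sum>q\<in>?M. \<Sum>d\<in>?BR q. \<Sum>w\<in>?CR (q, d). ?gR d w)"
    by (subst sum_Sigma_fst_snd) (simp_all add: finite_comp_pairs finite_decomps)
  also have "\<dots> = (\<Sum>(s, t)\<in>?M. half_coeff a i s t \<cdot> br (ad_word s x) (ad_word t y))"
  proof (intro sum.cong refl, clarify)
    fix s t
    have "half_coeff a i s t = (\<Sum>d\<in>decomps s \<times> decomps t.
        mu (sum_list (snd (fst d)) - i) (snd (fst d)) *
        mu_shuffle a (fst (fst d)) (fst (snd d)) ((sum_list (snd (fst d)) - i) # snd (snd d)))"
      by (simp add: half_coeff_def sum.cartesian_product case_prod_unfold)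
    then have "half_coeff a i s t \<cdot> br (ad_word s x) (ad_word t y) =
      (\<Sum>d\<in>decomps s \<times> decomps t. (mu (sum_list (snd (fst d)) - i) (snd (fst d)) *
        mu_shuffle a (fst (fst d)) (fst (snd d)) ((sum_list (snd (fst d)) - i) # snd (snd d))) \<cdot>
        br (ad_word s x) (ad_word t y))"
      by (simp only: fl.scale_sum_left)
    also have "\<dots> = (\<Sum>d\<in>decomps s \<times> decomps t. \<Sum>w\<in>?CR ((s, t), d). ?gR d w)"
    proof (intro sum.cong refl)
      fix d assume "d \<in> decomps s \<times> decomps t"
      then have "s = fst (fst d) @ snd (fst d)" "t = fst (snd d) @ snd (snd d)"
        by (auto simp: decomps_def)
      then show "(mu (sum_list (snd (fst d)) - i) (snd (fst d)) *
        mu_shuffle a (fst (fst d)) (fst (snd d)) ((sum_list (snd (fst d)) - i) # snd (snd d))) \<cdot>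
        br (ad_word s x) (ad_word t y) = (\<Sum>w\<in>?CR ((s, t), d). ?gR d w)"
        by (simp only: G_def mu_shuffle_def sum_distrib_left fl.scale_sum_left fst_conv snd_conv)
    qed
    finally show "(\<Sum>d\<in>?BR (s, t). \<Sum>w\<in>?CR ((s, t), d). ?gR d w) =
        half_coeff a i s t \<cdot> br (ad_word s x) (ad_word t y)"
      by (simp only: fst_conv snd_conv)
  qed
  finally show ?thesis .
qed

section \<open>The post-Lie identity\<close>

lemma uri_word_sum: "uri_word a n (sum f A) = (\<Sum>i\<in>A. uri_word a n (f i))"
  by (induction A rule: infinite_finite_induct) (simp_all add: uri_word_add)

text \<open>The two halves of the identity for d1 = i, d2 = j are the same coefficient with the two
  words exchanged; exchanging the arguments of the bracket produces the minus sign.\<close>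

lemma uri_word_br_insert_words:
  assumes id1: threshold_shuffle_identity_1
  shows "uri_word a (i + j) (br x y) = insert_words a i j x y - insert_words a j i y x"
proof -
  let ?M = "comp_pairs (a + i + j)"
  let ?G = "\<lambda>s t. br (ad_word s x) (ad_word t y)"
  have split: "mu_shuffle a s t [] = half_coeff a i s t + half_coeff a j t s" if "(s, t) \<in> ?M" for s t
  proof -
    have "mu_shuffle a s t [] = half_coeff a i s t + (\<Sum>(s1, s2)\<in>decomps s. \<Sum>(t1, t2)\<in>decomps t.
        mu (sum_list t2 - j) t2 * mu_shuffle a s1 t1 ((sum_list t2 - j) # s2))"
      using that threshold_shuffle_identity_1_nat[OF id1, of s t a i j]
      by (simp add: comp_pairs_def half_coeff_def sum.distrib case_prod_unfold)
    also have "(\<Sum>(s1, s2)\<in>decomps s. \<Sum>(t1, t2)\<in>decomps t.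
        mu (sum_list t2 - j) t2 * mu_shuffle a s1 t1 ((sum_list t2 - j) # s2)) = half_coeff a j t s"
      unfolding half_coeff_def case_prod_unfold
      by (subst sum.swap) (subst mu_shuffle_commute, rule refl)
    finally show ?thesis .
  qed
  have "insert_words a j i y x = (\<Sum>(t, s)\<in>?M. half_coeff a j t s \<cdot> br (ad_word t y) (ad_word s x))"
    by (simp only: insert_words_eq_half_coeff)
  also have "\<dots> = (\<Sum>(s, t)\<in>?M. - (half_coeff a j t s \<cdot> ?G s t))"
    by (rule sum.reindex_bij_witness[where i = prod.swap and j = prod.swap])
      (auto simp: comp_pairs_def br_anticomm[of "ad_word _ x"])
  finally have *: "insert_words a j i y x = - (\<Sum>(s, t)\<in>?M. half_coeff a j t s \<cdot> ?G s t)"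
    by (simp add: sum_negf case_prod_unfold)
  have "uri_word a (i + j) (br x y) = (\<Sum>(s, t)\<in>?M. mu_shuffle a s t [] \<cdot> ?G s t)"
    unfolding uri_word_br by (simp only: add.assoc)
  also have "\<dots> = (\<Sum>(s, t)\<in>?M. half_coeff a i s t \<cdot> ?G s t + half_coeff a j t s \<cdot> ?G s t)"
    by (intro sum.cong refl) (auto simp: split fl.scale_left_distrib)
  also have "\<dots> = insert_words a i j x y - insert_words a j i y x"
    unfolding * by (simp add: insert_words_eq_half_coeff sum.distrib case_prod_unfold add_ac)
  finally show ?thesis .
qed

lemma uri_tri_br_letter:
  assumes "1 \<le> a" and x: "\<forall>n\<ge>N. hasse n x = 0" and y: "\<forall>n\<ge>N. hasse n y = 0"
  shows "uri_tri (br x y) (letter a) =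
    (\<Sum>i<N. \<Sum>j<N. uri_word a (i + j) (br (hasse i x) (hasse j y)))"
proof -
  let ?f = "\<lambda>i j. uri_word a (i + j) (br (hasse i x) (hasse j y))"
  have "br (hasse i x) (hasse (n - i) y) = 0" if "n \<ge> N + N" for n i
    using x y that by (cases "i \<ge> N") auto
  then have "\<forall>n\<ge>N + N. hasse n (br x y) = 0"
    by (simp add: hasse_bracket)
  then have "uri_tri (br x y) (letter a) = (\<Sum>n<N + N. \<Sum>i\<le>n. ?f i (n - i))"
    using assms(1) by (simp add: uri_tri_letter hasse_bracket uri_word_sum)
  also have "\<dots> = (\<Sum>(i, j)\<in>{(i, j). i + j < N + N}. ?f i j)"
    by (rule sum.triangle_reindex[symmetric])
  \<comment> \<open>The square lies in the triangle i + j < N + N, and outside it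
    \<open>hasse i x\<close> or \<open>hasse j y\<close> is 0.\<close>
  also have "\<dots> = (\<Sum>(i, j)\<in>{..<N} \<times> {..<N}. ?f i j)"
  proof (rule sum.mono_neutral_right)
    show "finite {(i, j). i + j < N + N}"
      by (rule finite_subset[of _ "{..<N + N} \<times> {..<N + N}"]) auto
    show "\<forall>p\<in>{(i, j). i + j < N + N} - {..<N} \<times> {..<N}. (case p of (i, j) \<Rightarrow> ?f i j) = 0"
    proof (rule ballI)
      fix p assume p: "p \<in> {(i, j). i + j < N + N} - {..<N} \<times> {..<N}"
      obtain i j where ij: "p = (i, j)" by fastforce
      with p have "N \<le> i \<or> N \<le> j" by auto
      then show "(case p of (i, j) \<Rightarrow> ?f i j) = 0" using x y by (auto simp: ij)
    qed
  qed auto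
  finally show ?thesis by (simp add: sum.cartesian_product)
qed

text \<open>By the derivation rule x acts either on the argument \<open>hasse j y\<close>, which by
  \<open>hasse_uri_tri\<close> gives the components of \<open>uri_tri x y\<close>, or on a letter,
  which gives the insertions.\<close>

lemma uri_tri_uri_tri_letter:
  assumes a: "1 \<le> a" and x: "\<forall>n\<ge>N. hasse n x = 0" and y: "\<forall>n\<ge>N. hasse n y = 0"
  shows "uri_tri x (uri_tri y (letter a)) = uri_tri (uri_tri x y) (letter a) +
    (\<Sum>i<N. \<Sum>j<N. insert_words a i j (hasse i x) (hasse j y))"
proof -
  have "\<forall>n\<ge>N. hasse n (uri_tri x y) = 0"
    using y by (simp add: hasse_uri_tri)
  then have xy: "uri_tri (uri_tri x y) (letter a) = (\<Sum>j<N. uri_word a j (uri_tri x (hasse j y)))"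
    using a by (simp add: uri_tri_letter hasse_uri_tri)
  have tri: "uri_tri x (uri_word a j z) =
      uri_word a j (uri_tri x z) + (\<Sum>i<N. insert_words a i j (hasse i x) z)" for j z
  proof -
    have "mu a \<alpha> \<cdot> uri_tri x (ad_word \<alpha> z) = mu a \<alpha> \<cdot> ad_word \<alpha> (uri_tri x z) +
        (\<Sum>i<N. mu a \<alpha> \<cdot> (\<Sum>p<length \<alpha>.
          ad_word (take p \<alpha>) (br (uri_word (\<alpha> ! p) i (hasse i x)) (ad_word (drop (Suc p) \<alpha>) z))))"
      if "\<alpha> \<in> compositions (int (a + j))" for \<alpha>
    proof -
      have "(\<Sum>p<length \<alpha>. ad_word (take p \<alpha>) (br (uri_tri x (letter (\<alpha> ! p))) (ad_word (drop (Suc p) \<alpha>) z))) =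
        (\<Sum>p<length \<alpha>. \<Sum>i<N. ad_word (take p \<alpha>)
          (br (uri_word (\<alpha> ! p) i (hasse i x)) (ad_word (drop (Suc p) \<alpha>) z)))"
      proof (intro sum.cong refl)
        fix p assume "p \<in> {..<length \<alpha>}"
        then have "1 \<le> \<alpha> ! p" using that unfolding mem_compositions by auto
        then show "ad_word (take p \<alpha>) (br (uri_tri x (letter (\<alpha> ! p))) (ad_word (drop (Suc p) \<alpha>) z)) =
          (\<Sum>i<N. ad_word (take p \<alpha>) (br (uri_word (\<alpha> ! p) i (hasse i x)) (ad_word (drop (Suc p) \<alpha>) z)))"
          by (simp only: uri_tri_letter[OF _ x] br_sum ad_word_sum)
      qed
      then show ?thesis
        unfolding uri_tri_ad_word fl.scale_right_distrib fl.scale_sum_right[symmetric]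
        by (simp only: sum.swap[of _ "{..<N}"])
    qed
    then show ?thesis
      unfolding uri_word_def[of a] insert_words_def uri_tri_sum uri_tri_scale
      by (subst sum.swap) (simp only: sum.distrib[symmetric] cong: sum.cong)
  qed
  have "uri_tri x (uri_tri y (letter a)) = (\<Sum>j<N. uri_tri x (uri_word a j (hasse j y)))"
    by (simp only: uri_tri_letter[OF a y] uri_tri_sum)
  also have "\<dots> = uri_tri (uri_tri x y) (letter a) +
      (\<Sum>j<N. \<Sum>i<N. insert_words a i j (hasse i x) (hasse j y))"
    unfolding tri xy sum.distrib ..
  also have "(\<Sum>j<N. \<Sum>i<N. insert_words a i j (hasse i x) (hasse j y)) =
      (\<Sum>i<N. \<Sum>j<N. insert_words a i j (hasse i x) (hasse j y))"
    by (rule sum.swap)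
  finally show ?thesis .
qed

lemma uri_tri_post_lie:
  assumes id1: threshold_shuffle_identity_1
  shows "uri_tri (br x y) z =
    uri_tri x (uri_tri y z) - uri_tri (uri_tri x y) z - uri_tri y (uri_tri x z) + uri_tri (uri_tri y x) z"
proof (induction z rule: free_lie_induct)
  case (letter a)
  show ?case
  proof (cases "a = 0")
    case False
    then have a: "1 \<le> a" by simp
    obtain M N where "\<forall>n\<ge>M. hasse n x = 0" "\<forall>n\<ge>N. hasse n y = 0"
      using hasse_nilpotent by blast
    then have x: "\<forall>n\<ge>max M N. hasse n x = 0" and y: "\<forall>n\<ge>max M N. hasse n y = 0"
      by auto
    let ?I = "\<lambda>x y. \<Sum>i<max M N. \<Sum>j<max M N. insert_words a i j (hasse i x) (hasse j y)"
    have "uri_tri (br x y) (letter a) = ?I x y -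
        (\<Sum>i<max M N. \<Sum>j<max M N. insert_words a j i (hasse j y) (hasse i x))"
      by (simp only: uri_tri_br_letter[OF a x y] uri_word_br_insert_words[OF id1] sum_subtractf)
    also have "\<dots> = ?I x y - ?I y x"
      by (subst sum.swap) (rule refl)
    \<comment> \<open>After substituting the two double actions,
      \<open>uri_tri (uri_tri x y) (letter a)\<close> and its mirror image cancel and the insertions
      remain.\<close>
    finally show ?thesis
      by (simp add: uri_tri_uri_tri_letter[OF a x y] uri_tri_uri_tri_letter[OF a y x])
  qed simp
next
  case (add u v)
  then show ?case by (simp add: uri_tri_add)
next
  case (scale c u)
  then show ?case
    by (simp add: uri_tri_scale fl.scale_right_distrib fl.scale_right_diff_distrib)
next
  case (bracket z w)
  \<comment> \<open>The mixed terms \<open>br (uri_tri x z) (uri_tri y w)\<close> and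
    \<open>br (uri_tri y z) (uri_tri x w)\<close> occur in both double actions and cancel.\<close>
  then show ?case
    by (simp add: uri_tri_br uri_tri_add br_add br_diff)
qed simp

theorem theorem5p11:
  assumes "threshold_shuffle_identity_1"
    and "threshold_shuffle_identity_2"
  shows "post_lie_algebra free_lie_scale free_lie_bracket uri_tri"
proof unfold_locales
  fix x y z :: "nat free_lie"
  show "uri_tri x (br y z) = br (uri_tri x y) z + br y (uri_tri x z)"
    by (rule uri_tri_br)
  show "uri_tri (br x y) z =
      uri_tri x (uri_tri y z) - uri_tri (uri_tri x y) z - uri_tri y (uri_tri x z) +
      uri_tri (uri_tri y x) z"
    using assms(1) by (rule uri_tri_post_lie)
qed (simp_all add: uri_tri_add uri_tri_scale)

end
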